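(* Let $(T,\circ)$ be a unimodular network that is almost surely a tree, with $\mathbf{E}[\deg(\circ)]<\infty$ and with no leaves almost surely. For every integer $r\ge1$ let $S_r(T,\circ)=\{x\in V(T):\mathrm{dist}_T(\circ,x)=r\}$. Then $$\mathbf{E}\big[|S_r(T,\circ)|\big]\ \ge\ \mathbf{E}[\deg(\circ)]\cdot\exp\left\{(r-1)\frac{\mathbf{E}[\deg(\circ)\log(\deg(\circ)-1)]}{\mathbf{E}[\deg(\circ)]}\right\}\ \ge\ \mathbf{E}[\deg(\circ)]\,\big(\mathbf{E}[\deg(\circ)]-1\big)^{r-1}.$$
   Context: Graphs are simple and undirected. A rooted graph $(G,x)$ is a connected, locally finite graph $G$ with countably many vertices and a distinguished vertex $x$. $\mathcal{G}^*$ is the set of isomorphism classes of rooted graphs, with the Polish topology of local convergence: $(G_n,x_n)\to(G,x)$ iff for every $r$ the $r$-neighbourhoods of the roots are isomorphic as rooted graphs for all large $n$. A random rooted graph is a $\mathcal{G}^*$-valued random variable $(G,\circ)$. It is a unimodular network if $$\mathbf{E}\Big[\sum_{x\in V(G)}f(G,\circ,x)\Big]=\mathbf{E}\Big[\sum_{x\in V(G)}f(G,x,\circ)\Big]$$ for every non-negative measurable function $f$ on the space of isomorphism classes of doubly rooted graphs $(G,x,y)$. "No leaves" means that every vertex has degree at least $2$. $\mathrm{dist}_T$ is the graph distance. *)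

theory Defs
  imports "HOL-Probability.Probability"
begin

section \<open>Simple undirected graphs\<close>

datatype 'a graph = Graph (verts: "'a set") (adj: "('a \<times> 'a) set")

definition simple_graph :: "'a graph \<Rightarrow> bool" where
  "simple_graph G \<longleftrightarrow> adj G \<subseteq> verts G \<times> verts G \<and> sym (adj G) \<and> irrefl (adj G)"

definition neighbours :: "'a graph \<Rightarrow> 'a \<Rightarrow> 'a set" where
  "neighbours G x = adj G `` {x}"

definition vdegree :: "'a graph \<Rightarrow> 'a \<Rightarrow> nat" where
  "vdegree G x = card (neighbours G x)"

definition locally_finite :: "'a graph \<Rightarrow> bool" where
  "locally_finite G \<longleftrightarrow> (\<forall>x\<in>verts G. finite (neighbours G x))"

definition connected_graph :: "'a graph \<Rightarrow> bool" where
  "connected_graph G \<longleftrightarrow> (\<forall>x\<in>verts G. \<forall>y\<in>verts G. (x, y) \<in> (adj G)\<^sup>*)"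

(* Unspecified when no path joins x and y. *)
definition gdist :: "'a graph \<Rightarrow> 'a \<Rightarrow> 'a \<Rightarrow> nat" where
  "gdist G x y = (LEAST n. (x, y) \<in> adj G ^^ n)"

definition sphere_at :: "'a graph \<Rightarrow> 'a \<Rightarrow> nat \<Rightarrow> 'a set" where
  "sphere_at G x r = {y \<in> verts G. gdist G x y = r}"

definition is_cycle :: "'a graph \<Rightarrow> 'a list \<Rightarrow> bool" where
  "is_cycle G xs \<longleftrightarrow> 3 \<le> length xs \<and> distinct xs \<and>
     (\<forall>i < length xs. (xs ! i, xs ! (Suc i mod length xs)) \<in> adj G)"

definition tree_graph :: "'a graph \<Rightarrow> bool" where
  "tree_graph G \<longleftrightarrow> connected_graph G \<and> (\<nexists>xs. is_cycle G xs)"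

definition leafless :: "'a graph \<Rightarrow> bool" where
  "leafless G \<longleftrightarrow> (\<forall>x\<in>verts G. 2 \<le> vdegree G x)"

definition nbhd :: "'a graph \<Rightarrow> 'a set \<Rightarrow> nat \<Rightarrow> 'a graph" where
  "nbhd G A r =
     (let B = {x \<in> verts G. \<exists>a\<in>A. gdist G a x \<le> r} in Graph B (adj G \<inter> B \<times> B))"

definition graph_iso :: "('a \<Rightarrow> 'b) \<Rightarrow> 'a graph \<Rightarrow> 'b graph \<Rightarrow> bool" where
  "graph_iso \<phi> G H \<longleftrightarrow> bij_betw \<phi> (verts G) (verts H) \<and>
     (\<forall>x\<in>verts G. \<forall>y\<in>verts G. (x, y) \<in> adj G \<longleftrightarrow> (\<phi> x, \<phi> y) \<in> adj H)"

lemma graph_iso_id: "graph_iso id G G"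
  by (simp add: graph_iso_def)

lemma graph_iso_inv:
  assumes "graph_iso \<phi> G H"
  shows "graph_iso (inv_into (verts G) \<phi>) H G"
  using assms unfolding graph_iso_def
  by (smt (verit) bij_betw_def bij_betw_inv_into f_inv_into_f inv_into_into)

lemma graph_iso_comp:
  assumes "graph_iso \<phi> G H" "graph_iso \<psi> H K"
  shows "graph_iso (\<psi> \<circ> \<phi>) G K"
  using assms unfolding graph_iso_def
  by (auto intro: bij_betw_trans simp: bij_betw_apply)

lemma graph_iso_in: "graph_iso \<phi> G H \<Longrightarrow> x \<in> verts G \<Longrightarrow> \<phi> x \<in> verts H"
  by (auto simp: graph_iso_def bij_betw_apply)

lemma graph_iso_inv_apply:
  "graph_iso \<phi> G H \<Longrightarrow> x \<in> verts G \<Longrightarrow> inv_into (verts G) \<phi> (\<phi> x) = x"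
  by (auto simp: graph_iso_def bij_betw_def)

lemma graph_iso_inj:
  "graph_iso \<phi> G H \<Longrightarrow> x \<in> verts G \<Longrightarrow> y \<in> verts G \<Longrightarrow> \<phi> x = \<phi> y \<longleftrightarrow> x = y"
  by (auto simp: graph_iso_def bij_betw_def inj_on_def)

lemma graph_iso_surj:
  "graph_iso \<phi> G H \<Longrightarrow> y \<in> verts H \<Longrightarrow> \<exists>x\<in>verts G. y = \<phi> x"
  by (auto simp: graph_iso_def bij_betw_def)

lemma relpow_adj_closed:
  assumes "simple_graph G" "x \<in> verts G" "(x, y) \<in> adj G ^^ n"
  shows "y \<in> verts G"
  using assms by (cases n) (auto simp: simple_graph_def)

lemma graph_iso_relpow:
  assumes "simple_graph G" "simple_graph H" "graph_iso \<phi> G H" "x \<in> verts G" "y \<in> verts G"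
  shows "(x, y) \<in> adj G ^^ n \<longleftrightarrow> (\<phi> x, \<phi> y) \<in> adj H ^^ n"
  using assms(5)
proof (induction n arbitrary: y)
  case 0
  then show ?case using graph_iso_inj[OF assms(3,4)] by auto
next
  case (Suc n)
  show ?case
  proof
    assume "(x, y) \<in> adj G ^^ Suc n"
    then obtain z where z: "(x, z) \<in> adj G ^^ n" "(z, y) \<in> adj G" by auto
    have "z \<in> verts G" using relpow_adj_closed[OF assms(1,4) z(1)] .
    then show "(\<phi> x, \<phi> y) \<in> adj H ^^ Suc n"
      using z Suc assms(3) by (auto simp: graph_iso_def)
  next
    assume "(\<phi> x, \<phi> y) \<in> adj H ^^ Suc n"
    then obtain w where w: "(\<phi> x, w) \<in> adj H ^^ n" "(w, \<phi> y) \<in> adj H" by auto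
    have "w \<in> verts H"
      using relpow_adj_closed[OF assms(2) graph_iso_in[OF assms(3,4)] w(1)] .
    then obtain z where "z \<in> verts G" "w = \<phi> z" using graph_iso_surj[OF assms(3)] by blast
    then show "(x, y) \<in> adj G ^^ Suc n"
      using w Suc assms(3) by (auto simp: graph_iso_def)
  qed
qed

lemma graph_iso_gdist:
  assumes "simple_graph G" "simple_graph H" "graph_iso \<phi> G H" "x \<in> verts G" "y \<in> verts G"
  shows "gdist H (\<phi> x) (\<phi> y) = gdist G x y"
  using graph_iso_relpow[OF assms] by (simp add: gdist_def)

lemma gdist_self [simp]: "gdist G x x = 0"
  by (simp add: gdist_def Least_eq_0)

lemma graph_iso_sphere:
  assumes "simple_graph G" "simple_graph H" "graph_iso \<phi> G H" "x \<in> verts G"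
  shows "card (sphere_at H (\<phi> x) r) = card (sphere_at G x r)"
proof -
  have "sphere_at H (\<phi> x) r = \<phi> ` sphere_at G x r"
  proof (rule set_eqI)
    fix w
    show "w \<in> sphere_at H (\<phi> x) r \<longleftrightarrow> w \<in> \<phi> ` sphere_at G x r"
      using graph_iso_surj[OF assms(3), of w] graph_iso_in[OF assms(3)]
        graph_iso_gdist[OF assms]
      by (auto simp: sphere_at_def)
  qed
  moreover have "inj_on \<phi> (sphere_at G x r)"
    using assms(3) by (auto simp: graph_iso_def bij_betw_def sphere_at_def inj_on_def)
  ultimately show ?thesis by (simp add: card_image)
qed

lemma graph_iso_vdegree:
  assumes "simple_graph G" "simple_graph H" "graph_iso \<phi> G H" "x \<in> verts G"
  shows "vdegree H (\<phi> x) = vdegree G x"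
proof -
  have sub: "neighbours G x \<subseteq> verts G" "neighbours H (\<phi> x) \<subseteq> verts H"
    using assms(1,2) by (auto simp: neighbours_def simple_graph_def)
  have iff: "\<phi> y \<in> neighbours H (\<phi> x) \<longleftrightarrow> y \<in> neighbours G x" if "y \<in> verts G" for y
    using assms(3,4) that by (simp add: graph_iso_def neighbours_def)
  have "neighbours H (\<phi> x) = \<phi> ` neighbours G x"
  proof
    show "neighbours H (\<phi> x) \<subseteq> \<phi> ` neighbours G x"
    proof
      fix w assume w: "w \<in> neighbours H (\<phi> x)"
      then obtain y where "y \<in> verts G" "w = \<phi> y" using graph_iso_surj[OF assms(3)] sub(2) by blast
      then show "w \<in> \<phi> ` neighbours G x" using iff w by blast
    qed
    show "\<phi> ` neighbours G x \<subseteq> neighbours H (\<phi> x)" using iff sub(1) by blast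
  qed
  moreover have "inj_on \<phi> (neighbours G x)"
    using assms(3) inj_on_subset[OF _ sub(1)] unfolding graph_iso_def bij_betw_def by blast
  ultimately show ?thesis by (simp add: vdegree_def card_image)
qed

lemma graph_iso_leafless:
  assumes "simple_graph G" "simple_graph H" "graph_iso \<phi> G H"
  shows "leafless H \<longleftrightarrow> leafless G"
  using graph_iso_vdegree[OF assms] graph_iso_surj[OF assms(3)] graph_iso_in[OF assms(3)]
  unfolding leafless_def by metis

lemma graph_iso_connected:
  assumes "simple_graph G" "simple_graph H" "graph_iso \<phi> G H"
  shows "connected_graph H \<longleftrightarrow> connected_graph G"
  using graph_iso_relpow[OF assms] graph_iso_surj[OF assms(3)] graph_iso_in[OF assms(3)]
  unfolding connected_graph_def rtrancl_power by metis

lemma graph_iso_cycle: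
  assumes "simple_graph G" "simple_graph H" "graph_iso \<phi> G H" "is_cycle G xs"
  shows "is_cycle H (map \<phi> xs)"
proof -
  have sub: "set xs \<subseteq> verts G"
  proof
    fix a assume "a \<in> set xs"
    then obtain i where "i < length xs" "a = xs ! i" by (auto simp: in_set_conv_nth)
    then have "(a, xs ! (Suc i mod length xs)) \<in> adj G" using assms(4) by (auto simp: is_cycle_def)
    then show "a \<in> verts G" using assms(1) by (auto simp: simple_graph_def)
  qed
  then have "inj_on \<phi> (set xs)"
    using assms(3) by (auto simp: graph_iso_def bij_betw_def intro: inj_on_subset)
  moreover have "(\<phi> (xs ! i), \<phi> (xs ! (Suc i mod length xs))) \<in> adj H" if "i < length xs" for i
  proof -
    have "(xs ! i, xs ! (Suc i mod length xs)) \<in> adj G"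
      using assms(4) that by (auto simp: is_cycle_def)
    then show ?thesis using assms(1,3) by (auto simp: graph_iso_def simple_graph_def)
  qed
  moreover have "Suc i mod length xs < length xs" if "i < length xs" for i
    using that by (intro mod_less_divisor) auto
  ultimately show ?thesis using assms(4) by (auto simp: is_cycle_def distinct_map)
qed

lemma graph_iso_tree:
  assumes "simple_graph G" "simple_graph H" "graph_iso \<phi> G H"
  shows "tree_graph H \<longleftrightarrow> tree_graph G"
  using graph_iso_connected[OF assms] graph_iso_cycle[OF assms]
    graph_iso_cycle[OF assms(2,1) graph_iso_inv[OF assms(3)]]
  unfolding tree_graph_def by blast

lemma graph_iso_nbhd:
  assumes "simple_graph G" "simple_graph H" "graph_iso \<phi> G H" "A \<subseteq> verts G"
  shows "graph_iso \<phi> (nbhd G A r) (nbhd H (\<phi> ` A) r)"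
proof -
  define B where "B = {x \<in> verts G. \<exists>a\<in>A. gdist G a x \<le> r}"
  define C where "C = {x \<in> verts H. \<exists>a\<in>\<phi> ` A. gdist H a x \<le> r}"
  have B: "B \<subseteq> verts G" by (auto simp: B_def)
  have iff: "\<phi> x \<in> C \<longleftrightarrow> x \<in> B" if "x \<in> verts G" for x
  proof -
    have "gdist H (\<phi> a) (\<phi> x) = gdist G a x" if "a \<in> A" for a
      using graph_iso_gdist[OF assms(1-3) _ \<open>x \<in> verts G\<close>] assms(4) that by blast
    then show ?thesis
      using that graph_iso_in[OF assms(3) that] by (simp add: B_def C_def)
  qed
  have "C = \<phi> ` B"
  proof
    show "C \<subseteq> \<phi> ` B"
    proof
      fix w assume w: "w \<in> C"
      then have "w \<in> verts H" by (simp add: C_def)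
      then obtain x where "x \<in> verts G" "w = \<phi> x" using graph_iso_surj[OF assms(3)] by blast
      then show "w \<in> \<phi> ` B" using iff w by blast
    qed
    show "\<phi> ` B \<subseteq> C" using iff B by blast
  qed
  moreover have "inj_on \<phi> B"
    using assms(3) inj_on_subset[OF _ B] unfolding graph_iso_def bij_betw_def by blast
  ultimately have bij: "bij_betw \<phi> B C" by (simp add: bij_betw_def)
  have "(x, y) \<in> adj G \<inter> B \<times> B \<longleftrightarrow> (\<phi> x, \<phi> y) \<in> adj H \<inter> C \<times> C"
    if "x \<in> B" "y \<in> B" for x y
    using assms(3) B iff that unfolding graph_iso_def by blast
  then have "graph_iso \<phi> (Graph B (adj G \<inter> B \<times> B)) (Graph C (adj H \<inter> C \<times> C))"
    using bij unfolding graph_iso_def graph.sel by blast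
  then show ?thesis
    unfolding nbhd_def Let_def B_def[symmetric] C_def[symmetric] .
qed


section \<open>Isomorphism classes of rooted and doubly rooted graphs\<close>

(* Every connected, locally finite graph is countable, so vertex sets that are subsets of nat
   represent all isomorphism classes. *)
definition admissible :: "nat graph \<Rightarrow> bool" where
  "admissible G \<longleftrightarrow> simple_graph G \<and> locally_finite G \<and> connected_graph G"

definition rooted_iso :: "'a graph \<times> 'a \<Rightarrow> 'b graph \<times> 'b \<Rightarrow> bool" where
  "rooted_iso = (\<lambda>(G, x) (H, u). \<exists>\<phi>. graph_iso \<phi> G H \<and> \<phi> x = u)"

definition birooted_iso :: "'a graph \<times> 'a \<times> 'a \<Rightarrow> 'b graph \<times> 'b \<times> 'b \<Rightarrow> bool" where
  "birooted_iso = (\<lambda>(G, x, y) (H, u, v). \<exists>\<phi>. graph_iso \<phi> G H \<and> \<phi> x = u \<and> \<phi> y = v)"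

definition rooted_equiv :: "nat graph \<times> nat \<Rightarrow> nat graph \<times> nat \<Rightarrow> bool" where
  "rooted_equiv = (\<lambda>(G, x) (H, u). admissible G \<and> x \<in> verts G \<and>
     admissible H \<and> u \<in> verts H \<and> rooted_iso (G, x) (H, u))"

definition birooted_equiv :: "nat graph \<times> nat \<times> nat \<Rightarrow> nat graph \<times> nat \<times> nat \<Rightarrow> bool" where
  "birooted_equiv = (\<lambda>(G, x, y) (H, u, v). admissible G \<and> x \<in> verts G \<and> y \<in> verts G \<and>
     admissible H \<and> u \<in> verts H \<and> v \<in> verts H \<and> birooted_iso (G, x, y) (H, u, v))"

lemma rooted_iso_sym:
  assumes "rooted_iso (G, x) (H, u)" "x \<in> verts G"
  shows "rooted_iso (H, u) (G, x)"
  using assms graph_iso_inv graph_iso_inv_apply unfolding rooted_iso_def by fast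

lemma rooted_iso_trans:
  assumes "rooted_iso (G, x) (H, u)" "rooted_iso (H, u) (K, v)"
  shows "rooted_iso (G, x) (K, v)"
proof -
  obtain \<phi> \<psi> where "graph_iso \<phi> G H" "\<phi> x = u" "graph_iso \<psi> H K" "\<psi> u = v"
    using assms by (auto simp: rooted_iso_def)
  then show ?thesis
    by (auto simp: rooted_iso_def intro!: exI[of _ "\<psi> \<circ> \<phi>"] graph_iso_comp)
qed

lemma birooted_iso_sym:
  assumes "birooted_iso (G, x, y) (H, u, v)" "x \<in> verts G" "y \<in> verts G"
  shows "birooted_iso (H, u, v) (G, x, y)"
  using assms graph_iso_inv graph_iso_inv_apply unfolding birooted_iso_def by fast

lemma birooted_iso_trans:
  assumes "birooted_iso (G, x, y) (H, u, v)" "birooted_iso (H, u, v) (K, s, t)"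
  shows "birooted_iso (G, x, y) (K, s, t)"
proof -
  obtain \<phi> \<psi> where "graph_iso \<phi> G H" "\<phi> x = u" "\<phi> y = v"
    "graph_iso \<psi> H K" "\<psi> u = s" "\<psi> v = t"
    using assms by (auto simp: birooted_iso_def)
  then show ?thesis
    by (auto simp: birooted_iso_def intro!: exI[of _ "\<psi> \<circ> \<phi>"] graph_iso_comp)
qed

lemma rooted_iso_cong:
  assumes "rooted_iso (G, x) (G', x')" "rooted_iso (H, u) (H', u')" "x \<in> verts G" "u \<in> verts H"
  shows "rooted_iso (G, x) (H, u) \<longleftrightarrow> rooted_iso (G', x') (H', u')"
  using rooted_iso_trans[OF rooted_iso_sym[OF assms(1,3)] rooted_iso_trans[OF _ assms(2)]]
    rooted_iso_trans[OF assms(1) rooted_iso_trans[OF _ rooted_iso_sym[OF assms(2,4)]]]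
  by (rule iffI)

lemma birooted_iso_cong:
  assumes "birooted_iso (G, x, y) (G', x', y')" "birooted_iso (H, u, v) (H', u', v')"
    "x \<in> verts G" "y \<in> verts G" "u \<in> verts H" "v \<in> verts H"
  shows "birooted_iso (G, x, y) (H, u, v) \<longleftrightarrow> birooted_iso (G', x', y') (H', u', v')"
  using birooted_iso_trans[OF birooted_iso_sym[OF assms(1,3,4)] birooted_iso_trans[OF _ assms(2)]]
    birooted_iso_trans[OF assms(1) birooted_iso_trans[OF _ birooted_iso_sym[OF assms(2,5,6)]]]
  by (rule iffI)

lemma root_in_nbhd: "a \<in> A \<Longrightarrow> a \<in> verts G \<Longrightarrow> a \<in> verts (nbhd G A r)"
  by (auto simp: nbhd_def Let_def intro!: bexI[of _ a])

lemma admissible_singleton: "admissible (Graph {0} {})"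
  by (auto simp: admissible_def simple_graph_def locally_finite_def connected_graph_def
      neighbours_def sym_def irrefl_def)

lemma part_equivp_rooted_equiv: "part_equivp rooted_equiv"
proof (rule part_equivpI)
  show "\<exists>g. rooted_equiv g g"
    using admissible_singleton graph_iso_id
    by (intro exI[of _ "(Graph {0} {}, 0)"]) (auto simp: rooted_equiv_def rooted_iso_def intro!: exI[of _ id])
  show "symp rooted_equiv"
    by (auto simp: rooted_equiv_def symp_def intro: rooted_iso_sym)
  show "transp rooted_equiv"
    by (auto simp: rooted_equiv_def transp_def intro: rooted_iso_trans)
qed

lemma part_equivp_birooted_equiv: "part_equivp birooted_equiv"
proof (rule part_equivpI)
  show "\<exists>g. birooted_equiv g g"
    using admissible_singleton graph_iso_id
    by (intro exI[of _ "(Graph {0} {}, 0, 0)"])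
      (auto simp: birooted_equiv_def birooted_iso_def intro!: exI[of _ id])
  show "symp birooted_equiv"
    by (auto simp: birooted_equiv_def symp_def intro: birooted_iso_sym)
  show "transp birooted_equiv"
    by (auto simp: birooted_equiv_def transp_def intro: birooted_iso_trans)
qed

quotient_type gstar = "nat graph \<times> nat" / partial: rooted_equiv
  by (rule part_equivp_rooted_equiv)

quotient_type gstar2 = "nat graph \<times> nat \<times> nat" / partial: birooted_equiv
  by (rule part_equivp_birooted_equiv)

lemma rooted_equivE:
  assumes "rooted_equiv (G, x) (H, u)"
  obtains \<phi> where "graph_iso \<phi> G H" "u = \<phi> x" "x \<in> verts G" "simple_graph G" "simple_graph H"
    "admissible G" "admissible H"
  using assms by (auto simp: rooted_equiv_def rooted_iso_def admissible_def)

lemma birooted_equivE: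
  assumes "birooted_equiv (G, x, y) (H, u, v)"
  obtains \<phi> where "graph_iso \<phi> G H" "u = \<phi> x" "v = \<phi> y" "x \<in> verts G" "y \<in> verts G"
    "simple_graph G" "simple_graph H"
  using assms by (auto simp: birooted_equiv_def birooted_iso_def admissible_def)


section \<open>The topology of local convergence\<close>

lemma rooted_equiv_nbhd:
  assumes "rooted_equiv (G, x) (H, u)"
  shows "rooted_iso (nbhd G {x} r, x) (nbhd H {u} r, u)"
proof -
  from assms obtain \<phi> where "graph_iso \<phi> G H" "u = \<phi> x" "x \<in> verts G"
    "simple_graph G" "simple_graph H" by (rule rooted_equivE)
  then show ?thesis
    using graph_iso_nbhd[of G H \<phi> "{x}" r] by (auto simp: rooted_iso_def)
qed

lemma birooted_equiv_nbhd:
  assumes "birooted_equiv (G, x, y) (H, u, v)"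
  shows "birooted_iso (nbhd G {x, y} r, x, y) (nbhd H {u, v} r, u, v)"
proof -
  from assms obtain \<phi> where "graph_iso \<phi> G H" "u = \<phi> x" "v = \<phi> y" "x \<in> verts G" "y \<in> verts G"
    "simple_graph G" "simple_graph H" by (rule birooted_equivE)
  then show ?thesis
    using graph_iso_nbhd[of G H \<phi> "{x, y}" r] by (auto simp: birooted_iso_def)
qed

lift_definition same_nbhd :: "nat \<Rightarrow> gstar \<Rightarrow> gstar \<Rightarrow> bool"
  is "\<lambda>r (G, x) (H, u). rooted_iso (nbhd G {x} r, x) (nbhd H {u} r, u)"
  by (clarsimp, rule rooted_iso_cong)
    (auto simp: rooted_equiv_nbhd rooted_equiv_def intro: root_in_nbhd)

(* The r-neighbourhood of a doubly rooted graph is taken around both roots; balls around the first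
   root alone generate the same topology as soon as r is at least the distance of the roots. *)
lift_definition same_nbhd2 :: "nat \<Rightarrow> gstar2 \<Rightarrow> gstar2 \<Rightarrow> bool"
  is "\<lambda>r (G, x, y) (H, u, v). birooted_iso (nbhd G {x, y} r, x, y) (nbhd H {u, v} r, u, v)"
by (clarsimp, rule birooted_iso_cong)
    (auto simp: birooted_equiv_nbhd birooted_equiv_def intro: root_in_nbhd)

lemma same_nbhd_refl: "same_nbhd r g g"
  by transfer (auto simp: rooted_iso_def intro!: exI[of _ id] graph_iso_id)

lemma same_nbhd2_refl: "same_nbhd2 r g g"
  by transfer (auto simp: birooted_iso_def intro!: exI[of _ id] graph_iso_id)

lemma same_nbhd_trans_sym: "same_nbhd r g h \<Longrightarrow> same_nbhd r k h \<Longrightarrow> same_nbhd r g k"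
proof (transfer, clarsimp)
  fix r :: nat and G x H u K v
  assume *: "rooted_equiv (K, v) (K, v)"
    "rooted_iso (nbhd G {x} r, x) (nbhd H {u} r, u)"
    "rooted_iso (nbhd K {v} r, v) (nbhd H {u} r, u)"
  then have "v \<in> verts (nbhd K {v} r)"
    by (auto simp: rooted_equiv_def intro: root_in_nbhd)
  then show "rooted_iso (nbhd G {x} r, x) (nbhd K {v} r, v)"
    using rooted_iso_trans[OF *(2) rooted_iso_sym[OF *(3)]] by blast
qed

lemma same_nbhd2_trans_sym: "same_nbhd2 r g h \<Longrightarrow> same_nbhd2 r k h \<Longrightarrow> same_nbhd2 r g k"
proof (transfer, clarsimp)
  fix r :: nat and G x y H u v K s t
  assume *: "birooted_equiv (K, s, t) (K, s, t)"
    "birooted_iso (nbhd G {x, y} r, x, y) (nbhd H {u, v} r, u, v)"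
    "birooted_iso (nbhd K {s, t} r, s, t) (nbhd H {u, v} r, u, v)"
  then have "s \<in> verts (nbhd K {s, t} r)" "t \<in> verts (nbhd K {s, t} r)"
    by (auto simp: birooted_equiv_def intro: root_in_nbhd)
  then show "birooted_iso (nbhd G {x, y} r, x, y) (nbhd K {s, t} r, s, t)"
    using birooted_iso_trans[OF *(2) birooted_iso_sym[OF *(3)]] by blast
qed

(* Subbasis: the classes with a prescribed r-neighbourhood of the root(s). The two lemmas on
   convergence below state that this is the topology of local convergence. *)
instantiation gstar :: topological_space
begin

definition open_gstar :: "gstar set \<Rightarrow> bool" where
  "open_gstar = generate_topology {{h. same_nbhd r h g} |r g. True}"

instance
proof
  show "open (UNIV :: gstar set)"
    unfolding open_gstar_def by (rule generate_topology.UNIV)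
  show "open (S \<inter> T)" if "open S" "open T" for S T :: "gstar set"
    using that unfolding open_gstar_def by (rule generate_topology.Int)
  show "open (\<Union>K)" if "\<forall>S\<in>K. open S" for K :: "gstar set set"
    using that unfolding open_gstar_def by (blast intro: generate_topology.UN)
qed

end

instantiation gstar2 :: topological_space
begin

definition open_gstar2 :: "gstar2 set \<Rightarrow> bool" where
  "open_gstar2 = generate_topology {{h. same_nbhd2 r h g} |r g. True}"

instance
proof
  show "open (UNIV :: gstar2 set)"
    unfolding open_gstar2_def by (rule generate_topology.UNIV)
  show "open (S \<inter> T)" if "open S" "open T" for S T :: "gstar2 set"
    using that unfolding open_gstar2_def by (rule generate_topology.Int)
  show "open (\<Union>K)" if "\<forall>S\<in>K. open S" for K :: "gstar2 set set"
    using that unfolding open_gstar2_def by (blast intro: generate_topology.UN)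
qed

end

lemma tendsto_gstar_iff:
  "(f \<longlongrightarrow> g) F \<longleftrightarrow> (\<forall>r. \<forall>\<^sub>F i in F. same_nbhd r (f i) g)" for g :: gstar
proof -
  have "(f \<longlongrightarrow> g) F \<longleftrightarrow>
      (\<forall>S \<in> {S \<in> {{h. same_nbhd r h k} |r k. True}. g \<in> S}. \<forall>\<^sub>F i in F. f i \<in> S)"
    unfolding nhds_generated_topology[OF open_gstar_def] filterlim_INF filterlim_principal ..
  also have "\<dots> \<longleftrightarrow> (\<forall>r k. g \<in> {h. same_nbhd r h k} \<longrightarrow> (\<forall>\<^sub>F i in F. f i \<in> {h. same_nbhd r h k}))"
    by blast
  also have "\<dots> \<longleftrightarrow> (\<forall>r k. same_nbhd r g k \<longrightarrow> (\<forall>\<^sub>F i in F. same_nbhd r (f i) k))"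
    by (simp only: mem_Collect_eq)
  also have "\<dots> \<longleftrightarrow> (\<forall>r. \<forall>\<^sub>F i in F. same_nbhd r (f i) g)"
  proof (intro iffI allI impI)
    fix r assume "\<forall>r k. same_nbhd r g k \<longrightarrow> (\<forall>\<^sub>F i in F. same_nbhd r (f i) k)"
    then show "\<forall>\<^sub>F i in F. same_nbhd r (f i) g" using same_nbhd_refl by blast
  next
    fix r k assume *: "\<forall>r. \<forall>\<^sub>F i in F. same_nbhd r (f i) g" "same_nbhd r g k"
    have "same_nbhd r k g" using same_nbhd_trans_sym[OF same_nbhd_refl *(2)] .
    then have "same_nbhd r h k" if "same_nbhd r h g" for h using same_nbhd_trans_sym[OF that] by blast
    then show "\<forall>\<^sub>F i in F. same_nbhd r (f i) k"
      using *(1) by (blast intro: eventually_mono)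
  qed
  finally show ?thesis .
qed

lemma tendsto_gstar2_iff:
  "(f \<longlongrightarrow> g) F \<longleftrightarrow> (\<forall>r. \<forall>\<^sub>F i in F. same_nbhd2 r (f i) g)" for g :: gstar2
proof -
  have "(f \<longlongrightarrow> g) F \<longleftrightarrow>
      (\<forall>S \<in> {S \<in> {{h. same_nbhd2 r h k} |r k. True}. g \<in> S}. \<forall>\<^sub>F i in F. f i \<in> S)"
    unfolding nhds_generated_topology[OF open_gstar2_def] filterlim_INF filterlim_principal ..
  also have "\<dots> \<longleftrightarrow> (\<forall>r k. g \<in> {h. same_nbhd2 r h k} \<longrightarrow> (\<forall>\<^sub>F i in F. f i \<in> {h. same_nbhd2 r h k}))"
    by blast
  also have "\<dots> \<longleftrightarrow> (\<forall>r k. same_nbhd2 r g k \<longrightarrow> (\<forall>\<^sub>F i in F. same_nbhd2 r (f i) k))"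
    by (simp only: mem_Collect_eq)
  also have "\<dots> \<longleftrightarrow> (\<forall>r. \<forall>\<^sub>F i in F. same_nbhd2 r (f i) g)"
  proof (intro iffI allI impI)
    fix r assume "\<forall>r k. same_nbhd2 r g k \<longrightarrow> (\<forall>\<^sub>F i in F. same_nbhd2 r (f i) k)"
    then show "\<forall>\<^sub>F i in F. same_nbhd2 r (f i) g" using same_nbhd2_refl by blast
  next
    fix r k assume *: "\<forall>r. \<forall>\<^sub>F i in F. same_nbhd2 r (f i) g" "same_nbhd2 r g k"
    have "same_nbhd2 r k g" using same_nbhd2_trans_sym[OF same_nbhd2_refl *(2)] .
    then have "same_nbhd2 r h k" if "same_nbhd2 r h g" for h using same_nbhd2_trans_sym[OF that] by blast
    then show "\<forall>\<^sub>F i in F. same_nbhd2 r (f i) k"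
      using *(1) by (blast intro: eventually_mono)
  qed
  finally show ?thesis .
qed


section \<open>Quantities attached to a rooted graph\<close>

lift_definition root_degree :: "gstar \<Rightarrow> nat" is "\<lambda>(G, x). vdegree G x"
  by (auto elim!: rooted_equivE simp: graph_iso_vdegree)

lift_definition root_sphere_card :: "nat \<Rightarrow> gstar \<Rightarrow> nat" is "\<lambda>r (G, x). card (sphere_at G x r)"
  by (auto elim!: rooted_equivE simp: graph_iso_sphere)

lift_definition is_tree :: "gstar \<Rightarrow> bool" is "\<lambda>(G, x). tree_graph G"
  by (auto elim!: rooted_equivE simp: graph_iso_tree)

lift_definition no_leaves :: "gstar \<Rightarrow> bool" is "\<lambda>(G, x). leafless G"
  by (auto elim!: rooted_equivE simp: graph_iso_leafless)

lemma birooted_equiv_extend: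
  assumes "graph_iso \<phi> G H" "admissible G" "admissible H" "x \<in> verts G" "y \<in> verts G"
  shows "birooted_equiv (G, x, y) (H, \<phi> x, \<phi> y)"
  using assms graph_iso_in[OF assms(1)] by (auto simp: birooted_equiv_def birooted_iso_def)

(* Integration against counting measure is the (possibly infinite) sum over the vertices. *)
lift_definition mass_out :: "(gstar2 \<Rightarrow> ennreal) \<Rightarrow> gstar \<Rightarrow> ennreal"
  is "\<lambda>f (G, x). \<integral>\<^sup>+y. f (abs_gstar2 (G, x, y)) \<partial>count_space (verts G)"
proof -
  fix f :: "gstar2 \<Rightarrow> ennreal" and p q
  assume "rooted_equiv p q"
  moreover obtain G x H u where [simp]: "p = (G, x)" "q = (H, u)" by (metis surj_pair)
  ultimately have "rooted_equiv (G, x) (H, u)" by simp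
  then obtain \<phi> where \<phi>: "graph_iso \<phi> G H" "u = \<phi> x" "x \<in> verts G"
    "admissible G" "admissible H" by (rule rooted_equivE)
  have "abs_gstar2 (G, x, y) = abs_gstar2 (H, \<phi> x, \<phi> y)" if "y \<in> verts G" for y
    using birooted_equiv_extend[OF \<phi>(1,4,5,3) that] Quotient3_rel_abs[OF Quotient3_gstar2] by metis
  then have "(\<integral>\<^sup>+y. f (abs_gstar2 (G, x, y)) \<partial>count_space (verts G)) =
      (\<integral>\<^sup>+y. f (abs_gstar2 (H, u, \<phi> y)) \<partial>count_space (verts G))"
    using \<phi>(2) by (intro nn_integral_cong) simp
  also have "\<dots> = (\<integral>\<^sup>+y. f (abs_gstar2 (H, u, y)) \<partial>count_space (verts H))"
    using \<phi>(1) by (intro nn_integral_bij_count_space) (simp add: graph_iso_def)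
  finally show "(case p of (G, x) \<Rightarrow> \<integral>\<^sup>+y. f (abs_gstar2 (G, x, y)) \<partial>count_space (verts G)) =
    (case q of (G, x) \<Rightarrow> \<integral>\<^sup>+y. f (abs_gstar2 (G, x, y)) \<partial>count_space (verts G))"
    by simp
qed

lift_definition mass_in :: "(gstar2 \<Rightarrow> ennreal) \<Rightarrow> gstar \<Rightarrow> ennreal"
  is "\<lambda>f (G, x). \<integral>\<^sup>+y. f (abs_gstar2 (G, y, x)) \<partial>count_space (verts G)"
proof -
  fix f :: "gstar2 \<Rightarrow> ennreal" and p q
  assume "rooted_equiv p q"
  moreover obtain G x H u where [simp]: "p = (G, x)" "q = (H, u)" by (metis surj_pair)
  ultimately have "rooted_equiv (G, x) (H, u)" by simp
  then obtain \<phi> where \<phi>: "graph_iso \<phi> G H" "u = \<phi> x" "x \<in> verts G"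
    "admissible G" "admissible H" by (rule rooted_equivE)
  have "abs_gstar2 (G, y, x) = abs_gstar2 (H, \<phi> y, \<phi> x)" if "y \<in> verts G" for y
    using birooted_equiv_extend[OF \<phi>(1,4,5) that \<phi>(3)] Quotient3_rel_abs[OF Quotient3_gstar2] by metis
  then have "(\<integral>\<^sup>+y. f (abs_gstar2 (G, y, x)) \<partial>count_space (verts G)) =
      (\<integral>\<^sup>+y. f (abs_gstar2 (H, \<phi> y, u)) \<partial>count_space (verts G))"
    using \<phi>(2) by (intro nn_integral_cong) simp
  also have "\<dots> = (\<integral>\<^sup>+y. f (abs_gstar2 (H, y, u)) \<partial>count_space (verts H))"
    using \<phi>(1) by (intro nn_integral_bij_count_space) (simp add: graph_iso_def)
  finally show "(case p of (G, x) \<Rightarrow> \<integral>\<^sup>+y. f (abs_gstar2 (G, y, x)) \<partial>count_space (verts G)) =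
    (case q of (G, x) \<Rightarrow> \<integral>\<^sup>+y. f (abs_gstar2 (G, y, x)) \<partial>count_space (verts G))"
    by simp
qed


section \<open>Unimodular networks\<close>

definition random_rooted_graph :: "'w measure \<Rightarrow> ('w \<Rightarrow> gstar) \<Rightarrow> bool" where
  "random_rooted_graph M T \<longleftrightarrow> prob_space M \<and> T \<in> borel_measurable M"

definition unimodular_network :: "'w measure \<Rightarrow> ('w \<Rightarrow> gstar) \<Rightarrow> bool" where
  "unimodular_network M T \<longleftrightarrow> random_rooted_graph M T \<and>
     (\<forall>f \<in> borel_measurable borel.
        (\<integral>\<^sup>+\<omega>. mass_out f (T \<omega>) \<partial>M) = (\<integral>\<^sup>+\<omega>. mass_in f (T \<omega>) \<partial>M))"

(* The exponential extended by exp \<infinity> = \<infinity>: integrability of deg does not imply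
   integrability of deg * log (deg - 1), so the exponent of the lower bound can be infinite. *)
definition exp_ennreal :: "ennreal \<Rightarrow> ennreal" where
  "exp_ennreal x = (if x = \<top> then \<top> else ennreal (exp (enn2real x)))"

end

theory Submission
  imports Defs "HOL-Library.Transitive_Closure_Table"
begin

text \<open>
  In a leafless tree the non-backtracking random walk from \<open>v\<close> reaches a vertex \<open>y\<close> at
  distance \<open>n\<close> after \<open>n\<close> steps with probability \<open>W y / deg v\<close>, where \<open>W y\<close> is the product of
  \<open>1 / (deg z - 1)\<close> over the interior vertices \<open>z\<close> of the geodesic. Hence \<open>W\<close> sums to
  \<open>deg v\<close> over the sphere, and \<open>W\<close> is symmetric in its end points, so mass transport with
  \<open>W y * ln (deg y - 1)\<close> shows that every step of the walk started at the degree-biased root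
  has the same expected log-branching. The first inequality is then Jensen's inequality for
  \<open>exp\<close> applied to \<open>1 = W y * exp (- ln (W y))\<close>, in the form of a tangent line so that infinite
  expectations need no special care; the second is convexity of \<open>x * ln (x - 1)\<close> for \<open>x \<ge> 2\<close>.
\<close>

section \<open>Geodesics\<close>

definition at_dist :: "'a graph \<Rightarrow> nat \<Rightarrow> 'a \<Rightarrow> 'a \<Rightarrow> bool" where
  "at_dist G n x y \<longleftrightarrow> (x, y) \<in> adj G ^^ n \<and> (\<forall>m<n. (x, y) \<notin> adj G ^^ m)"

text \<open>Described by walks rather than by \<^const>\<open>gdist\<close>, which is unspecified between different
  components of a neighbourhood of two roots.\<close>
definition geodesic_interior :: "'a graph \<Rightarrow> nat \<Rightarrow> 'a \<Rightarrow> 'a \<Rightarrow> 'a set" where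
  "geodesic_interior G n x y = {z. \<exists>j. 0 < j \<and> j < n \<and> (x, z) \<in> adj G ^^ j \<and> (z, y) \<in> adj G ^^ (n - j)}"

lemma relpow_sym:
  assumes "sym R" "(x, y) \<in> R ^^ n"
  shows "(y, x) \<in> R ^^ n"
  using assms(2)
proof (induction n arbitrary: y)
  case (Suc n)
  then obtain z where "(x, z) \<in> R ^^ n" "(z, y) \<in> R" by auto
  with Suc.IH assms(1) show ?case by (meson relpow_Suc_I2 symD)
qed auto

lemma at_dist_sym: "simple_graph G \<Longrightarrow> at_dist G n x y \<longleftrightarrow> at_dist G n y x"
  unfolding at_dist_def simple_graph_def using relpow_sym by metis

lemma geodesic_interior_sym:
  assumes "simple_graph G"
  shows "geodesic_interior G n x y = geodesic_interior G n y x"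
proof -
  have "geodesic_interior G n x y \<subseteq> geodesic_interior G n y x" for x y
  proof
    fix z assume "z \<in> geodesic_interior G n x y"
    then obtain j where j: "0 < j" "j < n" "(x, z) \<in> adj G ^^ j" "(z, y) \<in> adj G ^^ (n - j)"
      by (auto simp: geodesic_interior_def)
    with assms have "(z, x) \<in> adj G ^^ j" "(y, z) \<in> adj G ^^ (n - j)"
      by (auto simp: simple_graph_def intro: relpow_sym)
    with j show "z \<in> geodesic_interior G n y x"
      unfolding geodesic_interior_def by (intro CollectI exI[of _ "n - j"]) auto
  qed
  then show ?thesis by blast
qed

lemma sphere_at_iff:
  assumes "simple_graph G" "connected_graph G" "x \<in> verts G"
  shows "y \<in> sphere_at G x n \<longleftrightarrow> at_dist G n x y"
proof
  assume y: "y \<in> sphere_at G x n"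
  then obtain m where "(x, y) \<in> adj G ^^ m"
    using assms by (auto simp: sphere_at_def connected_graph_def rtrancl_power)
  with y show "at_dist G n x y"
    using LeastI[of "\<lambda>n. (x, y) \<in> adj G ^^ n"] not_less_Least[of _ "\<lambda>n. (x, y) \<in> adj G ^^ n"]
    by (auto simp: sphere_at_def gdist_def at_dist_def)
next
  assume y: "at_dist G n x y"
  then have "(LEAST n. (x, y) \<in> adj G ^^ n) = n"
    by (intro Least_equality) (auto simp: at_dist_def not_less[symmetric])
  with y show "y \<in> sphere_at G x n"
    using relpow_adj_closed[OF assms(1,3)] by (auto simp: sphere_at_def gdist_def at_dist_def)
qed

lemma at_dist_inj: "at_dist G m x y \<Longrightarrow> at_dist G n x y \<Longrightarrow> m = n"
  unfolding at_dist_def by (metis linorder_neqE_nat)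

lemma at_dist_ex: "(x, y) \<in> adj G ^^ n \<Longrightarrow> \<exists>m\<le>n. at_dist G m x y"
  unfolding at_dist_def
  by (intro exI[of _ "LEAST n. (x, y) \<in> adj G ^^ n"]) (auto intro: LeastI Least_le dest: not_less_Least)

text \<open>A walk to \<open>p\<close> with fewer than \<open>n\<close> steps would extend to a walk
  to \<open>y\<close> with fewer than \<open>n + 1\<close> steps.\<close>

lemma at_dist_pred:
  assumes "at_dist G (Suc n) x y"
  obtains p where "at_dist G n x p" "(p, y) \<in> adj G"
proof -
  from assms obtain p where p: "(x, p) \<in> adj G ^^ n" "(p, y) \<in> adj G"
    by (auto simp: at_dist_def)
  have "(x, p) \<notin> adj G ^^ m" if "m < n" for m
    using assms that p(2) relpow_Suc_I unfolding at_dist_def by fastforce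
  with p that show ?thesis by (auto simp: at_dist_def)
qed

section \<open>Parents and children in a leafless tree\<close>

locale leafless_tree =
  fixes G :: "'a graph" and v :: 'a
  assumes simple: "simple_graph G" and locally_finite: "locally_finite G"
    and tree: "tree_graph G" and leafless: "leafless G" and root: "v \<in> verts G"
begin

abbreviation S :: "nat \<Rightarrow> 'a set" where
  "S n \<equiv> sphere_at G v n"

definition weight :: "nat \<Rightarrow> 'a \<Rightarrow> real" where
  "weight n y = (\<Prod>z\<in>geodesic_interior G n v y. 1 / (real (vdegree G z) - 1))"

lemma in_S_iff: "y \<in> S n \<longleftrightarrow> at_dist G n v y"
  using sphere_at_iff simple tree root unfolding tree_graph_def by metis

lemma adj_sym: "(x, y) \<in> adj G \<Longrightarrow> (y, x) \<in> adj G"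
  using simple by (auto simp: simple_graph_def dest: symD)

text \<open>The vertices before \<open>p\<close> on a shortest walk from \<open>v\<close> have
  distance less than \<open>k\<close>, so none of them is \<open>y\<close>.\<close>

lemma avoiding_path:
  assumes "at_dist G k v y" "at_dist G n v p" "n \<le> k" "p \<noteq> y"
  shows "(\<lambda>a b. (a, b) \<in> adj G \<and> a \<noteq> y \<and> b \<noteq> y)\<^sup>*\<^sup>* v p"
  using assms(2-4)
proof (induction n arbitrary: p)
  case 0
  then show ?case by (auto simp: at_dist_def)
next
  case (Suc n)
  from Suc.prems(1) obtain q where q: "at_dist G n v q" "(q, p) \<in> adj G"
    by (rule at_dist_pred)
  have "q \<noteq> y" using at_dist_inj[OF q(1)] assms(1) Suc.prems(2) by auto
  then show ?case
    using Suc.IH[OF q(1)] Suc.prems q(2) by (auto intro: rtranclp.rtrancl_into_rtrancl)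
qed

text \<open>Two such neighbours would be joined through \<open>v\<close> by a path avoiding
  \<open>y\<close>, and \<open>y\<close> would close it to a cycle. The bounds
  \<open>m \<le> k\<close> and \<open>n \<le> k\<close> also cover neighbours on the level of
  \<open>y\<close> itself, so at most one neighbour of \<open>y\<close> fails to lie farther
  out.\<close>

lemma lower_neighbour_unique:
  assumes "at_dist G k v y" "(p, y) \<in> adj G" "(q, y) \<in> adj G"
    "at_dist G m v p" "at_dist G n v q" "m \<le> k" "n \<le> k"
  shows "p = q"
proof (rule ccontr)
  assume "p \<noteq> q"
  let ?R = "\<lambda>a b. (a, b) \<in> adj G \<and> a \<noteq> y \<and> b \<noteq> y"
  have "p \<noteq> y" "q \<noteq> y"
    using assms(2,3) simple by (auto simp: simple_graph_def irrefl_def)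
  then have "?R\<^sup>*\<^sup>* v p" "?R\<^sup>*\<^sup>* v q" using avoiding_path assms by blast+
  moreover have "symp ?R" using adj_sym by (auto intro: sympI)
  ultimately have "?R\<^sup>*\<^sup>* p q" by (meson rtranclp_trans sympD symp_rtranclp)
  \<comment> \<open>\<open>rtrancl_path\<close> lists in \<open>us\<close> the vertices after the
    start \<open>p\<close>, so \<open>us\<close> ends in \<open>q\<close>.\<close>
  then obtain us where "rtrancl_path ?R p us q" by (auto simp: rtranclp_eq_rtrancl_path)
  then obtain us where us: "rtrancl_path ?R p us q" "distinct (p # us)"
    by (rule rtrancl_path_distinct)
  have ne: "us \<noteq> []" using us(1) \<open>p \<noteq> q\<close> by (auto elim: rtrancl_path.cases)
  have step: "?R ((p # us) ! i) (us ! i)" if "i < length us" for i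
    using rtrancl_path_nth[OF us(1) that] .
  have "last us = q" using rtrancl_path_last[OF us(1) ne] .
  have "y \<notin> set us" using step by (auto simp: in_set_conv_nth)
  \<comment> \<open>The edge from \<open>y\<close> to \<open>p\<close>, the path along
    \<open>us\<close>, and the edge from \<open>q = last us\<close> back to \<open>y\<close>. As
    \<open>p \<noteq> q\<close>, the list \<open>us\<close> is nonempty and the length is at least
    3.\<close>
  let ?c = "y # p # us"
  have "is_cycle G ?c"
    unfolding is_cycle_def
  proof (intro conjI allI impI)
    show "3 \<le> length ?c" using ne by (cases us) auto
    show "distinct ?c" using us(2) \<open>y \<notin> set us\<close> \<open>p \<noteq> y\<close> by auto
  next
    fix i assume i: "i < length ?c"
    show "(?c ! i, ?c ! (Suc i mod length ?c)) \<in> adj G"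
    proof (cases "Suc i = length ?c")
      case True
      then have "?c ! i = q" using ne \<open>last us = q\<close> by (auto simp: last_conv_nth nth_Cons split: nat.split)
      with True assms(3) show ?thesis by simp
    next
      case False
      with i have "Suc i mod length ?c = Suc i" by simp
      moreover have "(?c ! i, ?c ! Suc i) \<in> adj G"
      proof (cases i)
        case 0
        then show ?thesis using adj_sym[OF assms(2)] by simp
      next
        case (Suc j)
        with i False step[of j] show ?thesis by auto
      qed
      ultimately show ?thesis by simp
    qed
  qed
  with tree show False by (auto simp: tree_graph_def)
qed

lemma finite_neighbours: "finite (neighbours G x)"
proof (cases "x \<in> verts G")
  case False
  then have "neighbours G x = {}" using simple by (auto simp: simple_graph_def neighbours_def)
  then show ?thesis by simp
qed (use locally_finite in \<open>auto simp: locally_finite_def\<close>)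

lemma parentE:
  assumes "y \<in> S (Suc n)"
  obtains p where "p \<in> S n" "y \<in> neighbours G p"
  using assms at_dist_pred unfolding in_S_iff neighbours_def by (metis Image_singleton_iff)

lemma parent_unique:
  assumes "y \<in> S (Suc n)" "p \<in> S n" "q \<in> S n" "y \<in> neighbours G p" "y \<in> neighbours G q"
  shows "p = q"
  using lower_neighbour_unique[of "Suc n" y p q n n] assms
  by (auto simp: in_S_iff neighbours_def)

lemma sphere_Suc: "S (Suc n) = (\<Union>p\<in>S n. neighbours G p \<inter> S (Suc n))"
  using parentE by blast

lemma sphere_0: "S 0 = {v}"
  by (auto simp: in_S_iff at_dist_def)

lemma sphere_1: "S (Suc 0) = neighbours G v"
  using simple
  by (auto simp: in_S_iff at_dist_def neighbours_def simple_graph_def irrefl_def)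

lemma finite_sphere: "finite (S n)"
proof (induction n)
  case (Suc n)
  show ?case by (subst sphere_Suc) (use Suc finite_neighbours in auto)
qed (simp add: sphere_0)

lemma sum_sphere_Suc:
  "(\<Sum>y\<in>S (Suc n). h y) = (\<Sum>p\<in>S n. \<Sum>y\<in>neighbours G p \<inter> S (Suc n). h y)"
  for h :: "'a \<Rightarrow> real"
  by (subst sphere_Suc, rule sum.UNION_disjoint)
    (use finite_sphere finite_neighbours parent_unique in \<open>auto 0 3\<close>)

text \<open>By \<open>lower_neighbour_unique\<close> the parent is the only neighbour off the next
  level. The condition \<open>0 < n\<close> excludes the root, all of whose neighbours are
  children.\<close>

lemma card_children:
  assumes "y \<in> S n" "0 < n"
  shows "card (neighbours G y \<inter> S (Suc n)) = vdegree G y - 1"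
proof -
  obtain m where n: "n = Suc m" using assms(2) by (cases n) auto
  obtain p where p: "p \<in> S m" "y \<in> neighbours G p" using assms(1) parentE unfolding n by blast
  have "neighbours G y \<inter> S (Suc n) = neighbours G y - {p}"
  proof (intro equalityI subsetI)
    fix z assume z: "z \<in> neighbours G y \<inter> S (Suc n)"
    then have "z \<noteq> p" using p at_dist_inj[of G "Suc n" v z m] by (auto simp: in_S_iff n)
    with z show "z \<in> neighbours G y - {p}" by auto
  next
    fix z assume z: "z \<in> neighbours G y - {p}"
    then have zy: "(y, z) \<in> adj G" by (auto simp: neighbours_def)
    with assms(1) have "(v, z) \<in> adj G ^^ Suc n" by (auto simp: in_S_iff at_dist_def)
    then obtain k where k: "k \<le> Suc n" "at_dist G k v z" using at_dist_ex by metis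
    have "\<not> k \<le> n"
    proof
      assume "k \<le> n"
      then have "z = p"
        using lower_neighbour_unique[of n y z p k m] k assms(1) p adj_sym[OF zy]
        by (auto simp: in_S_iff neighbours_def n)
      with z show False by simp
    qed
    with k z show "z \<in> neighbours G y \<inter> S (Suc n)" by (auto simp: in_S_iff le_Suc_eq)
  qed
  moreover have "p \<in> neighbours G y" using p adj_sym by (auto simp: neighbours_def)
  ultimately show ?thesis by (simp add: vdegree_def)
qed

section \<open>Weights of geodesics and their sums over spheres\<close>

lemma geodesic_interior_1: "geodesic_interior G (Suc 0) v y = {}"
  by (auto simp: geodesic_interior_def)

text \<open>On a walk of length \<open>n + 1\<close> from \<open>v\<close> to \<open>y\<close> the
  last vertex before \<open>y\<close> is within distance \<open>n\<close> of \<open>v\<close>, so it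
  is \<open>p\<close> by \<open>lower_neighbour_unique\<close>. For \<open>0 < n\<close> the vertex
  \<open>p\<close> differs from the end point \<open>v\<close> and joins the interior.\<close>

lemma geodesic_interior_Suc:
  assumes "y \<in> S (Suc n)" "p \<in> S n" "y \<in> neighbours G p" "0 < n"
  shows "geodesic_interior G (Suc n) v y = insert p (geodesic_interior G n v p)"
proof (intro equalityI subsetI)
  have py: "(p, y) \<in> adj G" using assms(3) by (simp add: neighbours_def)
  have vp: "(v, p) \<in> adj G ^^ n" using assms(2) by (simp add: in_S_iff at_dist_def)
  {
    fix z assume "z \<in> geodesic_interior G (Suc n) v y"
    then obtain j where j: "0 < j" "j \<le> n" "(v, z) \<in> adj G ^^ j" "(z, y) \<in> adj G ^^ Suc (n - j)"
      by (auto simp: geodesic_interior_def Suc_diff_le)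
    then obtain q where q: "(z, q) \<in> adj G ^^ (n - j)" "(q, y) \<in> adj G" by auto
    have "(v, q) \<in> adj G ^^ (j + (n - j))" using relpow_trans[OF j(3) q(1)] .
    then obtain k where k: "k \<le> n" "at_dist G k v q"
      using at_dist_ex[where x = v and y = q and n = n and G = G] j(2) by auto
    have "q = p"
      using lower_neighbour_unique[of "Suc n" y q p k n] q(2) k py assms(1,2) by (simp add: in_S_iff)
    \<comment> \<open>\<open>j = n\<close> leaves a walk of length 0 from \<open>z\<close> to
      \<open>p\<close>, so \<open>z = p\<close>; a smaller \<open>j\<close> puts \<open>z\<close>
      inside the geodesic to \<open>p\<close>.\<close>
    then show "z \<in> insert p (geodesic_interior G n v p)"
      using q(1) j by (cases "j = n") (auto simp: geodesic_interior_def)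
  next
    fix z assume "z \<in> insert p (geodesic_interior G n v p)"
    then consider "z = p" | "z \<in> geodesic_interior G n v p" by blast
    then show "z \<in> geodesic_interior G (Suc n) v y"
    proof cases
      case 1
      with vp py assms(4) show ?thesis by (auto simp: geodesic_interior_def intro!: exI[of _ n])
    next
      case 2
      then obtain j where j: "0 < j" "j < n" "(v, z) \<in> adj G ^^ j" "(z, p) \<in> adj G ^^ (n - j)"
        by (auto simp: geodesic_interior_def)
      then have "(z, y) \<in> adj G ^^ (Suc n - j)" using py by (auto simp: Suc_diff_le)
      with j show ?thesis by (auto simp: geodesic_interior_def intro!: exI[of _ j])
    qed
  }
qed

lemma parent_notin_geodesic_interior: "p \<in> S n \<Longrightarrow> p \<notin> geodesic_interior G n v p"
  by (auto simp: geodesic_interior_def in_S_iff at_dist_def)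

lemma finite_geodesic_interior: "y \<in> S n \<Longrightarrow> finite (geodesic_interior G n v y)"
proof (induction n arbitrary: y)
  case (Suc n)
  show ?case
  proof (cases n)
    case (Suc m)
    obtain p where "p \<in> S n" "y \<in> neighbours G p" using Suc.prems parentE by blast
    with geodesic_interior_Suc[OF Suc.prems this] Suc.IH Suc show ?thesis by simp
  qed (simp add: geodesic_interior_1)
qed (simp add: geodesic_interior_def)

lemma degree_ge:
  assumes "y \<in> S n"
  shows "2 \<le> vdegree G y"
  using assms leafless by (auto simp: sphere_at_def leafless_def)

lemma degree_geodesic_interior: "y \<in> geodesic_interior G n v x \<Longrightarrow> 2 \<le> vdegree G y"
  using leafless relpow_adj_closed[OF simple root] by (auto simp: geodesic_interior_def leafless_def)

lemma weight_Suc: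
  assumes "y \<in> S (Suc n)" "p \<in> S n" "y \<in> neighbours G p" "0 < n"
  shows "weight (Suc n) y = weight n p / (real (vdegree G p) - 1)"
  using geodesic_interior_Suc[OF assms] finite_geodesic_interior[OF assms(2)] parent_notin_geodesic_interior[OF assms(2)]
  by (simp add: weight_def)

text \<open>Conservation of mass: the \<open>vdegree G p - 1\<close> children cancel the
  denominator, which is at least 1. The factor \<open>c\<close> is 1 in \<open>sum_weight\<close>
  and the sum of \<open>g\<close> along the geodesic up to and including \<open>p\<close> in
  \<open>sum_weight_geodesic\<close>.\<close>

lemma sum_children:
  assumes "p \<in> S n" "0 < n"
  shows "(\<Sum>y\<in>neighbours G p \<inter> S (Suc n). weight n p / (real (vdegree G p) - 1) * c) = weight n p * c"
  using degree_ge[OF assms(1)] card_children[OF assms] by (simp add: of_nat_diff)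

lemma sum_weight:
  assumes "0 < n"
  shows "(\<Sum>y\<in>S n. weight n y) = real (vdegree G v)"
  using assms
proof (induction n rule: nat_induct_non_zero)
  case 1
  \<comment> \<open>On the first sphere the interiors are empty, so every weight is 1 and the sum
    counts the neighbours of \<open>v\<close>.\<close>
  then show ?case by (simp add: sphere_1 weight_def geodesic_interior_1 vdegree_def)
next
  case (Suc n)
  have "(\<Sum>y\<in>S (Suc n). weight (Suc n) y) =
      (\<Sum>p\<in>S n. \<Sum>y\<in>neighbours G p \<inter> S (Suc n). weight n p / (real (vdegree G p) - 1) * 1)"
    unfolding sum_sphere_Suc using weight_Suc Suc.hyps by (intro sum.cong) auto
  also have "\<dots> = (\<Sum>p\<in>S n. weight n p)"
    using sum_children[of _ n 1] Suc.hyps by (intro sum.cong) auto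
  finally show ?case using Suc.IH by simp
qed

text \<open>The weights of the descendants of \<open>z \<in> S i\<close> on level \<open>n\<close>
  add up to \<open>weight i z\<close>, so the weighted sums along geodesics split into one term per
  level. Level 0 is absent because \<open>v\<close> is not an interior vertex.\<close>

lemma sum_weight_geodesic:
  fixes g :: "'a \<Rightarrow> real"
  assumes "0 < n"
  shows "(\<Sum>y\<in>S n. weight n y * (\<Sum>z\<in>geodesic_interior G n v y. g z)) =
    (\<Sum>i = 1..<n. \<Sum>z\<in>S i. weight i z * g z)"
  using assms
proof (induction n rule: nat_induct_non_zero)
  case 1
  then show ?case by (simp add: geodesic_interior_1)
next
  case (Suc n)
  let ?t = "\<lambda>p. (\<Sum>z\<in>geodesic_interior G n v p. g z)"
  have "(\<Sum>y\<in>S (Suc n). weight (Suc n) y * (\<Sum>z\<in>geodesic_interior G (Suc n) v y. g z)) =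
      (\<Sum>p\<in>S n. \<Sum>y\<in>neighbours G p \<inter> S (Suc n). weight n p / (real (vdegree G p) - 1) * (g p + ?t p))"
    unfolding sum_sphere_Suc
    using weight_Suc geodesic_interior_Suc finite_geodesic_interior parent_notin_geodesic_interior Suc.hyps
    by (intro sum.cong) auto
  also have "\<dots> = (\<Sum>p\<in>S n. weight n p * (g p + ?t p))"
    using sum_children Suc.hyps by (intro sum.cong) auto
  also have "\<dots> = (\<Sum>p\<in>S n. weight n p * ?t p) + (\<Sum>p\<in>S n. weight n p * g p)"
    by (simp add: distrib_left sum.distrib)
  finally show ?case using Suc by simp
qed

lemma weight_eq_exp: "weight n y = exp (- (\<Sum>z\<in>geodesic_interior G n v y. ln (real (vdegree G z) - 1)))"
proof (cases "finite (geodesic_interior G n v y)")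
  case True
  have "weight n y = (\<Prod>z\<in>geodesic_interior G n v y. exp (- ln (real (vdegree G z) - 1)))"
    unfolding weight_def
  proof (rule prod.cong)
    fix z assume "z \<in> geodesic_interior G n v y"
    then show "1 / (real (vdegree G z) - 1) = exp (- ln (real (vdegree G z) - 1))"
      using degree_geodesic_interior[of z n y] by (simp add: exp_minus field_simps)
  qed simp
  with True show ?thesis by (simp add: exp_sum sum_negf[symmetric])
\<comment> \<open>Over an infinite index set the product is 1 and the sum is 0, so both sides equal
  1.\<close>
qed (simp add: weight_def)

lemma weight_nonneg: "0 \<le> weight n y"
  by (simp add: weight_eq_exp)

text \<open>Summing the tangent line inequality \<open>exp t \<ge> exp c * (1 + t - c)\<close>, taken at
  \<open>t = - ln (weight n y)\<close>, against the weights.\<close>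
lemma card_sphere_ge:
  fixes c :: real
  assumes "0 < n"
  shows "exp c * (real (vdegree G v) +
      (\<Sum>i = 1..<n. \<Sum>z\<in>S i. weight i z * ln (real (vdegree G z) - 1)))
    \<le> real (card (S n)) + exp c * c * real (vdegree G v)"
proof -
  let ?t = "\<lambda>y. \<Sum>z\<in>geodesic_interior G n v y. ln (real (vdegree G z) - 1)"
  have "weight n y * (exp c * (1 + ?t y)) \<le> 1 + exp c * c * weight n y" for y
  proof -
    have "1 + (?t y - c) \<le> exp (?t y - c)" by (rule exp_ge_add_one_self)
    then have "weight n y * exp c * (1 + (?t y - c)) \<le> weight n y * exp c * exp (?t y - c)"
      by (intro mult_left_mono) (auto simp: weight_nonneg)
    also have "\<dots> = 1" by (simp add: weight_eq_exp flip: exp_add)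
    finally show ?thesis by (simp add: algebra_simps)
  qed
  then have "(\<Sum>y\<in>S n. weight n y * (exp c * (1 + ?t y))) \<le> (\<Sum>y\<in>S n. 1 + exp c * c * weight n y)"
    by (intro sum_mono)
  also have "\<dots> = real (card (S n)) + exp c * c * real (vdegree G v)"
    using sum_weight[OF assms] by (simp add: sum.distrib flip: sum_distrib_left)
  also have "(\<Sum>y\<in>S n. weight n y * (exp c * (1 + ?t y))) =
      exp c * ((\<Sum>y\<in>S n. weight n y) + (\<Sum>y\<in>S n. weight n y * ?t y))"
    by (simp add: sum_distrib_left sum.distrib algebra_simps)
  finally show ?thesis
    unfolding sum_weight[OF assms] sum_weight_geodesic[OF assms] .
qed

end


section \<open>Local transport functions\<close>

lemma nbhd_adj_subset: "adj (nbhd G A R) \<subseteq> adj G"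
  by (auto simp: nbhd_def Let_def)

lemma nbhd_verts_subset: "verts (nbhd G A R) \<subseteq> verts G"
  by (auto simp: nbhd_def Let_def)

lemma simple_nbhd: "simple_graph G \<Longrightarrow> simple_graph (nbhd G A R)"
  by (auto simp: simple_graph_def nbhd_def Let_def irrefl_def intro!: symI dest: symD)

lemma in_nbhd:
  assumes "simple_graph G" "a \<in> A" "a \<in> verts G" "(a, z) \<in> adj G ^^ k" "k \<le> R"
  shows "z \<in> verts (nbhd G A R)"
proof -
  have "gdist G a z \<le> R"
    using assms(4,5) unfolding gdist_def by (meson Least_le le_trans)
  with assms relpow_adj_closed[OF assms(1,3,4)] show ?thesis
    by (auto simp: nbhd_def Let_def)
qed

text \<open>A walk of length \<open>m\<close> from a vertex \<open>k\<close> steps away from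
  \<open>a\<close> stays within \<open>k + m \<le> R\<close> steps of \<open>a\<close> and survives
  in the neighbourhood. The offset \<open>k\<close> serves the second half of a geodesic, which need
  not start at a root.\<close>

lemma nbhd_relpow:
  assumes "simple_graph G" "a \<in> A" "a \<in> verts G" "(a, z) \<in> adj G ^^ k" "k + m \<le> R"
  shows "(z, y) \<in> adj (nbhd G A R) ^^ m \<longleftrightarrow> (z, y) \<in> adj G ^^ m"
proof
  show "(z, y) \<in> adj G ^^ m" if "(z, y) \<in> adj (nbhd G A R) ^^ m"
    using that nbhd_adj_subset[of G A R] by (induction m arbitrary: y) auto
  show "(z, y) \<in> adj (nbhd G A R) ^^ m" if "(z, y) \<in> adj G ^^ m"
    using that assms(5)
  proof (induction m arbitrary: y)
    case (Suc m)
    from Suc.prems(1) obtain w where w: "(z, w) \<in> adj G ^^ m" "(w, y) \<in> adj G" by auto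
    have aw: "(a, w) \<in> adj G ^^ (k + m)" using relpow_trans[OF assms(4) w(1)] .
    then have ay: "(a, y) \<in> adj G ^^ Suc (k + m)" using w(2) by auto
    have "w \<in> verts (nbhd G A R)" "y \<in> verts (nbhd G A R)"
      using in_nbhd[OF assms(1-3) aw] in_nbhd[OF assms(1-3) ay] Suc.prems(2) by auto
    with w(2) have "(w, y) \<in> adj (nbhd G A R)" by (auto simp: nbhd_def Let_def)
    moreover have "(z, w) \<in> adj (nbhd G A R) ^^ m" using Suc w(1) by simp
    ultimately show ?case by auto
  qed simp
qed

lemma nbhd_vdegree:
  assumes "simple_graph G" "a \<in> A" "a \<in> verts G" "(a, z) \<in> adj G ^^ k" "k < R"
  shows "vdegree (nbhd G A R) z = vdegree G z"
  using nbhd_relpow[OF assms(1-4), of 1 R] assms(5)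
  by (auto simp: vdegree_def neighbours_def intro!: arg_cong[of _ _ card])

text \<open>One family for two uses: with both functions constantly 1 it is the indicator of
  distance \<open>n\<close>, whose mass out is the size of the sphere; with
  \<open>child_probability\<close> and \<open>log_branching\<close> it is the weight of the geodesic
  times the log-branching at its end. Only the second root enters through \<open>\<phi>\<close>, and
  mass transport exploits this asymmetry.\<close>

definition path_weight :: "(nat \<Rightarrow> real) \<Rightarrow> (nat \<Rightarrow> real) \<Rightarrow> nat \<Rightarrow> 'a graph \<Rightarrow> 'a \<Rightarrow> 'a \<Rightarrow> real" where
  "path_weight \<psi> \<phi> n G x y = (if at_dist G n x y
     then (\<Prod>z\<in>geodesic_interior G n x y. \<psi> (vdegree G z)) * \<phi> (vdegree G y) else 0)"

text \<open>The condition \<open>n < R\<close> leaves one step beyond the geodesic, so that its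
  vertices, including the end point \<open>y\<close>, keep their degrees.\<close>

lemma path_weight_nbhd:
  assumes "simple_graph G" "x \<in> A" "x \<in> verts G" "n < R"
  shows "path_weight \<psi> \<phi> n (nbhd G A R) x y = path_weight \<psi> \<phi> n G x y"
proof -
  have root: "(x, x) \<in> adj G ^^ 0" by simp
  note R = nbhd_relpow[OF assms(1-3)]
  have R0: "(x, z) \<in> adj (nbhd G A R) ^^ j \<longleftrightarrow> (x, z) \<in> adj G ^^ j" if "j \<le> n" for z j
    using R[OF root] that assms(4) by simp
  have "at_dist (nbhd G A R) n x y \<longleftrightarrow> at_dist G n x y"
    using R0 by (auto simp: at_dist_def)
  moreover have "geodesic_interior (nbhd G A R) n x y = geodesic_interior G n x y"
    unfolding geodesic_interior_def
  proof (intro Collect_cong ex_cong1)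
    fix z j
    show "(0 < j \<and> j < n \<and> (x, z) \<in> adj (nbhd G A R) ^^ j \<and> (z, y) \<in> adj (nbhd G A R) ^^ (n - j)) \<longleftrightarrow>
      (0 < j \<and> j < n \<and> (x, z) \<in> adj G ^^ j \<and> (z, y) \<in> adj G ^^ (n - j))"
      using R0[of j z] R[of z j "n - j" R y] assms(4) by auto
  qed
  moreover have "vdegree (nbhd G A R) z = vdegree G z" if "z \<in> geodesic_interior G n x y" for z
    using that nbhd_vdegree[OF assms(1-3)] assms(4) by (force simp: geodesic_interior_def)
  moreover have "vdegree (nbhd G A R) y = vdegree G y" if "at_dist G n x y"
    using that nbhd_vdegree[OF assms(1-3)] assms(4) by (auto simp: at_dist_def)
  ultimately show ?thesis by (auto simp: path_weight_def)
qed

lemma path_weight_iso: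
  assumes "simple_graph G" "simple_graph H" "graph_iso f G H" "x \<in> verts G" "y \<in> verts G"
  shows "path_weight \<psi> \<phi> n H (f x) (f y) = path_weight \<psi> \<phi> n G x y"
proof -
  have "at_dist H n (f x) (f y) \<longleftrightarrow> at_dist G n x y"
    using graph_iso_relpow[OF assms] by (simp add: at_dist_def)
  moreover have sub: "geodesic_interior G n x y \<subseteq> verts G"
    using relpow_adj_closed[OF assms(1,4)] by (auto simp: geodesic_interior_def)
  moreover have "geodesic_interior H n (f x) (f y) = f ` geodesic_interior G n x y"
  proof -
    have "f z \<in> geodesic_interior H n (f x) (f y) \<longleftrightarrow> z \<in> geodesic_interior G n x y"
      if "z \<in> verts G" for z
      using graph_iso_relpow[OF assms(1-3,4) that] graph_iso_relpow[OF assms(1-3) that assms(5)]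
      by (simp add: geodesic_interior_def)
    moreover have "geodesic_interior H n (f x) (f y) \<subseteq> verts H"
      using relpow_adj_closed[OF assms(2) graph_iso_in[OF assms(3,4)]]
      by (auto simp: geodesic_interior_def)
    ultimately show ?thesis using sub graph_iso_surj[OF assms(3)] by blast
  qed
  moreover have "inj_on f (geodesic_interior G n x y)"
    using assms(3) inj_on_subset[OF _ sub] unfolding graph_iso_def bij_betw_def by blast
  moreover have "vdegree H (f z) = vdegree G z" if "z \<in> verts G" for z
    using graph_iso_vdegree[OF assms(1-3) that] .
  ultimately show ?thesis
    using assms(5) by (simp add: path_weight_def prod.reindex subset_iff)
qed

lift_definition transport :: "(nat \<Rightarrow> real) \<Rightarrow> (nat \<Rightarrow> real) \<Rightarrow> nat \<Rightarrow> gstar2 \<Rightarrow> ennreal"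
  is "\<lambda>\<psi> \<phi> n (G, x, y). ennreal (path_weight \<psi> \<phi> n G x y)"
  by (auto elim!: birooted_equivE simp: path_weight_iso)

text \<open>The value can be computed inside the neighbourhood of radius \<open>n + 1\<close>, where
  the isomorphism acts. Such local constancy yields the Borel measurability that
  \<open>unimodular_network\<close> asks of a transport function.\<close>

lemma transport_local:
  assumes "same_nbhd2 (Suc n) g h"
  shows "transport \<psi> \<phi> n g = transport \<psi> \<phi> n h"
  using assms
proof (transfer, clarsimp)
  fix \<psi> \<phi> :: "nat \<Rightarrow> real" and n G x y H u v
  assume g: "birooted_equiv (G, x, y) (G, x, y)" and h: "birooted_equiv (H, u, v) (H, u, v)"
    and "birooted_iso (nbhd G {x, y} (Suc n), x, y) (nbhd H {u, v} (Suc n), u, v)"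
  then obtain f where f: "graph_iso f (nbhd G {x, y} (Suc n)) (nbhd H {u, v} (Suc n))"
    "f x = u" "f y = v" by (auto simp: birooted_iso_def)
  have G: "simple_graph G" "x \<in> verts G" "y \<in> verts G" and H: "simple_graph H" "u \<in> verts H"
    using g h by (auto simp: birooted_equiv_def admissible_def)
  have "path_weight \<psi> \<phi> n (nbhd H {u, v} (Suc n)) u v = path_weight \<psi> \<phi> n (nbhd G {x, y} (Suc n)) x y"
    using path_weight_iso[OF simple_nbhd simple_nbhd f(1), of x y] G H f(2,3)
    by (simp add: root_in_nbhd)
  then show "ennreal (path_weight \<psi> \<phi> n G x y) = ennreal (path_weight \<psi> \<phi> n H u v)"
    using G H by (simp add: path_weight_nbhd)
qed

lemma mass_out_transport_abs:
  assumes "rooted_equiv (G, x) (G, x)"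
  shows "mass_out (transport \<psi> \<phi> n) (abs_gstar (G, x)) =
    (\<integral>\<^sup>+y. ennreal (path_weight \<psi> \<phi> n G x y) \<partial>count_space (verts G))"
proof -
  have "birooted_equiv (G, x, y) (G, x, y)" if "y \<in> verts G" for y
    using assms that birooted_equiv_extend[OF graph_iso_id, of G x y] by (simp add: rooted_equiv_def)
  then show ?thesis
    unfolding mass_out.abs_eq[OF assms] prod.case
    by (intro nn_integral_cong) (simp add: transport.abs_eq)
qed

lemma mass_in_transport_abs:
  assumes "rooted_equiv (G, x) (G, x)"
  shows "mass_in (transport \<psi> \<phi> n) (abs_gstar (G, x)) =
    (\<integral>\<^sup>+y. ennreal (path_weight \<psi> \<phi> n G y x) \<partial>count_space (verts G))"
proof -
  have "birooted_equiv (G, y, x) (G, y, x)" if "y \<in> verts G" for y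
    using assms that birooted_equiv_extend[OF graph_iso_id, of G y x] by (simp add: rooted_equiv_def)
  then show ?thesis
    unfolding mass_in.abs_eq[OF assms] prod.case
    by (intro nn_integral_cong) (simp add: transport.abs_eq)
qed

lemma gstar_cases:
  obtains G x where "g = abs_gstar (G, x)" "rooted_equiv (G, x) (G, x)"
proof -
  obtain G x where "rep_gstar g = (G, x)" by fastforce
  with Quotient3_abs_rep[OF Quotient3_gstar, of g] Quotient3_rep_reflp[OF Quotient3_gstar, of g]
  show ?thesis by (intro that[of G x]) auto
qed

text \<open>Only vertices within distance \<open>n\<close> of the root receive mass, so the sum
  lives on a ball and the isomorphism of balls reindexes it.\<close>

lemma mass_out_transport_local:
  assumes "same_nbhd (Suc n) g h"
  shows "mass_out (transport \<psi> \<phi> n) g = mass_out (transport \<psi> \<phi> n) h"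
proof -
  obtain G x where g: "g = abs_gstar (G, x)" "rooted_equiv (G, x) (G, x)" by (rule gstar_cases)
  obtain H u where h: "h = abs_gstar (H, u)" "rooted_equiv (H, u) (H, u)" by (rule gstar_cases)
  let ?w = "\<lambda>G x y. ennreal (path_weight \<psi> \<phi> n G x y)"
  let ?K = "\<lambda>G x. nbhd G {x} (Suc n)"
  have restrict: "(\<integral>\<^sup>+y. ?w G x y \<partial>count_space (verts G)) =
      (\<integral>\<^sup>+y. ?w (?K G x) x y \<partial>count_space (verts (?K G x)))"
    if "rooted_equiv (G, x) (G, x)" for G x
  proof -
    have G: "simple_graph G" "x \<in> verts G" using that by (auto simp: rooted_equiv_def admissible_def)
    have "?w G x y = 0" if "y \<notin> verts (?K G x)" for y
      using that in_nbhd[OF G(1) _ G(2), of "{x}" y n "Suc n"] by (auto simp: path_weight_def at_dist_def)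
    then have "(\<integral>\<^sup>+y. ?w G x y \<partial>count_space (verts G)) =
        (\<integral>\<^sup>+y. ?w G x y \<partial>count_space (verts (?K G x)))"
      using nbhd_verts_subset[of G "{x}" "Suc n"] by (intro nn_integral_count_space_eq) auto
    then show ?thesis using G by (simp add: path_weight_nbhd)
  qed
  from assms g h have "rooted_iso (?K G x, x) (?K H u, u)"
    by (simp add: same_nbhd.abs_eq)
  then obtain f where f: "graph_iso f (?K G x) (?K H u)" "f x = u" by (auto simp: rooted_iso_def)
  have G: "simple_graph G" "x \<in> verts G" and H: "simple_graph H"
    using g h by (auto simp: rooted_equiv_def admissible_def)
  have "(\<integral>\<^sup>+y. ?w (?K G x) x y \<partial>count_space (verts (?K G x))) =
      (\<integral>\<^sup>+y. ?w (?K H u) u (f y) \<partial>count_space (verts (?K G x)))"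
    using path_weight_iso[OF simple_nbhd[OF G(1)] simple_nbhd[OF H] f(1), of x] G(2) f(2)
    by (intro nn_integral_cong) (simp add: root_in_nbhd)
  also have "\<dots> = (\<integral>\<^sup>+y. ?w (?K H u) u y \<partial>count_space (verts (?K H u)))"
    using f(1) by (intro nn_integral_bij_count_space) (simp add: graph_iso_def)
  finally show ?thesis
    unfolding g(1) h(1) mass_out_transport_abs[OF g(2)] mass_out_transport_abs[OF h(2)]
      restrict[OF g(2)] restrict[OF h(2)] .
qed

section \<open>Borel measurability of local functions\<close>

lemma open_same_nbhd: "open {h. same_nbhd r h g}"
  unfolding open_gstar_def by (rule generate_topology.Basis) blast

lemma open_same_nbhd2: "open {h. same_nbhd2 r h g}"
  unfolding open_gstar2_def by (rule generate_topology.Basis) blast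

text \<open>Each point of a preimage has its \<open>U\<close> inside that preimage, so all preimages
  are open.\<close>

lemma measurable_locally_constant:
  fixes F :: "'a::topological_space \<Rightarrow> 'b::topological_space"
  assumes "\<And>g. \<exists>U. open U \<and> g \<in> U \<and> (\<forall>h\<in>U. F h = F g)"
  shows "F \<in> borel_measurable borel"
proof (rule borel_measurableI)
  fix A :: "'b set"
  have "open (F -` A)"
  proof (subst open_subopen, intro ballI)
    fix g assume "g \<in> F -` A"
    moreover obtain U where "open U" "g \<in> U" "\<forall>h\<in>U. F h = F g" using assms by blast
    ultimately show "\<exists>U. open U \<and> g \<in> U \<and> U \<subseteq> F -` A" 
      by (intro exI[of _ U]) (metis subsetI vimage_eq)
  qed
  then show "F -` A \<inter> space borel \<in> sets borel" by simp
qed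

lemma measurable_transport: "transport \<psi> \<phi> n \<in> borel_measurable borel"
proof (rule measurable_locally_constant)
  fix g
  show "\<exists>U. open U \<and> g \<in> U \<and> (\<forall>h\<in>U. transport \<psi> \<phi> n h = transport \<psi> \<phi> n g)"
    using open_same_nbhd2[of "Suc n" g] same_nbhd2_refl transport_local
    by (intro exI[of _ "{h. same_nbhd2 (Suc n) h g}"]) auto
qed

text \<open>Allows the integral of a sum of such masses to be split in the theorem.\<close>

lemma measurable_mass_out_transport: "mass_out (transport \<psi> \<phi> n) \<in> borel_measurable borel"
proof (rule measurable_locally_constant)
  fix g
  show "\<exists>U. open U \<and> g \<in> U \<and>
      (\<forall>h\<in>U. mass_out (transport \<psi> \<phi> n) h = mass_out (transport \<psi> \<phi> n) g)"
    using open_same_nbhd[of "Suc n" g] same_nbhd_refl mass_out_transport_local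
    by (intro exI[of _ "{h. same_nbhd (Suc n) h g}"]) auto
qed


section \<open>Mass transport in leafless trees\<close>

text \<open>Distance and interior do not see the direction, so exchanging the roots only moves
  \<open>\<phi>\<close> to the other end. This trades the degree at distance \<open>n\<close> for
  the degree at the root.\<close>

lemma path_weight_sym:
  assumes "simple_graph G"
  shows "path_weight \<psi> \<phi> n G y x = (if at_dist G n x y
    then (\<Prod>z\<in>geodesic_interior G n x y. \<psi> (vdegree G z)) * \<phi> (vdegree G x) else 0)"
  using at_dist_sym[OF assms] geodesic_interior_sym[OF assms, of n x y]
  by (auto simp: path_weight_def)

definition child_probability :: "nat \<Rightarrow> real" where
  "child_probability k = 1 / (real k - 1)"

definition log_branching :: "nat \<Rightarrow> real" where
  "log_branching k = ln (real k - 1)"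

context leafless_tree
begin

lemma path_weight_eq:
  "path_weight child_probability \<phi> n G v y = (if y \<in> S n then weight n y * \<phi> (vdegree G y) else 0)"
  by (simp add: path_weight_def in_S_iff weight_def child_probability_def)

lemma path_weight_rev_eq:
  "path_weight child_probability \<phi> n G y v = (if y \<in> S n then weight n y * \<phi> (vdegree G v) else 0)"
  by (simp add: path_weight_sym[OF simple] in_S_iff weight_def child_probability_def)

lemma nn_integral_sphere:
  assumes "\<And>y. y \<in> S n \<Longrightarrow> 0 \<le> h y" "\<And>y. y \<notin> S n \<Longrightarrow> h y = 0"
  shows "(\<integral>\<^sup>+y. ennreal (h y) \<partial>count_space (verts G)) = ennreal (\<Sum>y\<in>S n. h y)"
proof -
  have "(\<integral>\<^sup>+y. ennreal (h y) \<partial>count_space (verts G)) = (\<Sum>y\<in>S n. ennreal (h y))"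
    using finite_sphere assms(2) by (intro nn_integral_count_space') (auto simp: sphere_at_def)
  with assms(1) show ?thesis by simp
qed

lemma degree_root: "2 \<le> vdegree G v"
  using leafless root by (auto simp: leafless_def)

end

lemma leafless_treeE:
  assumes "is_tree g" "no_leaves g"
  obtains G v where "leafless_tree G v" "g = abs_gstar (G, v)" "rooted_equiv (G, v) (G, v)"
proof -
  obtain G v where g: "g = abs_gstar (G, v)" "rooted_equiv (G, v) (G, v)" by (rule gstar_cases)
  with assms have "tree_graph G" "leafless G" by (simp_all add: is_tree.abs_eq no_leaves.abs_eq)
  with g that show ?thesis
    by (auto simp: leafless_tree_def rooted_equiv_def admissible_def)
qed

lemma root_degree_ge_2: "is_tree g \<Longrightarrow> no_leaves g \<Longrightarrow> 2 \<le> root_degree g"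
  by (erule (1) leafless_treeE) (simp add: root_degree.abs_eq leafless_tree.degree_root)

lemma mass_out_unit:
  assumes "is_tree g" "no_leaves g"
  shows "mass_out (transport (\<lambda>_. 1) (\<lambda>_. 1) n) g = ennreal (real (root_sphere_card n g))"
proof -
  obtain G v where G: "leafless_tree G v" "g = abs_gstar (G, v)" "rooted_equiv (G, v) (G, v)"
    using leafless_treeE[OF assms] .
  then interpret leafless_tree G v by simp
  have "(\<integral>\<^sup>+y. ennreal (path_weight (\<lambda>_. 1) (\<lambda>_. 1) n G v y) \<partial>count_space (verts G)) =
      ennreal (\<Sum>y\<in>S n. path_weight (\<lambda>_. 1) (\<lambda>_. 1) n G v y)"
    by (rule nn_integral_sphere) (auto simp: path_weight_def in_S_iff)
  also have "(\<Sum>y\<in>S n. path_weight (\<lambda>_. 1) (\<lambda>_. 1) n G v y) = real (card (S n))"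
    by (simp add: path_weight_def in_S_iff)
  finally show ?thesis using G by (simp add: mass_out_transport_abs root_sphere_card.abs_eq)
qed

text \<open>Seen from the receiving root the factor \<open>log_branching\<close> is constant, and
  the weights sum to the degree. That \<open>n\<close> drops out is the stationarity of the
  degree-biased walk.\<close>

lemma mass_in_log_branching:
  assumes "is_tree g" "no_leaves g" "0 < n"
  shows "mass_in (transport child_probability log_branching n) g =
    ennreal (real (root_degree g) * ln (real (root_degree g) - 1))"
proof -
  obtain G v where G: "leafless_tree G v" "g = abs_gstar (G, v)" "rooted_equiv (G, v) (G, v)"
    using leafless_treeE[OF assms(1,2)] .
  then interpret leafless_tree G v by simp
  have "(\<integral>\<^sup>+y. ennreal (path_weight child_probability log_branching n G y v) \<partial>count_space (verts G)) =
      ennreal (\<Sum>y\<in>S n. path_weight child_probability log_branching n G y v)"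
    using degree_root weight_nonneg
    by (intro nn_integral_sphere) (auto simp: path_weight_rev_eq log_branching_def)
  also have "(\<Sum>y\<in>S n. path_weight child_probability log_branching n G y v) =
      (\<Sum>y\<in>S n. weight n y) * ln (real (vdegree G v) - 1)"
    by (simp add: path_weight_rev_eq log_branching_def sum_distrib_right)
  finally show ?thesis
    using G sum_weight[OF assms(3)] by (simp add: mass_in_transport_abs root_degree.abs_eq)
qed

text \<open>\<open>card_sphere_ge\<close> for isomorphism classes, with the sphere sums written as
  masses. The subtracted term stays on the right because subtraction in \<open>ennreal\<close> is
  truncated, and \<open>0 \<le> c\<close> keeps its coefficient \<open>exp c * c\<close>
  nonnegative.\<close>

lemma root_sphere_card_ge:
  fixes c :: real
  assumes "is_tree g" "no_leaves g" "0 < n" "0 \<le> c"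
  shows "ennreal (exp c) * (ennreal (real (root_degree g)) +
      (\<Sum>i = 1..<n. mass_out (transport child_probability log_branching i) g))
    \<le> mass_out (transport (\<lambda>_. 1) (\<lambda>_. 1) n) g + ennreal (exp c * c) * ennreal (real (root_degree g))"
proof -
  obtain G v where G: "leafless_tree G v" "g = abs_gstar (G, v)" "rooted_equiv (G, v) (G, v)"
    using leafless_treeE[OF assms(1,2)] .
  then interpret leafless_tree G v by simp
  let ?h = "\<lambda>i. \<Sum>z\<in>S i. weight i z * ln (real (vdegree G z) - 1)"
  \<comment> \<open>Degrees of at least 2 make the logarithm nonnegative, so \<open>ennreal\<close>
    cuts off no term.\<close>
  have nonneg: "0 \<le> weight i z * ln (real (vdegree G z) - 1)" if "z \<in> S i" for i z
    using weight_nonneg degree_ge[OF that] by (intro mult_nonneg_nonneg) auto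
  have "mass_out (transport child_probability log_branching i) g = ennreal (?h i)" for i
  proof -
    have "(\<integral>\<^sup>+y. ennreal (path_weight child_probability log_branching i G v y) \<partial>count_space (verts G)) =
        ennreal (\<Sum>y\<in>S i. path_weight child_probability log_branching i G v y)"
      using nonneg by (intro nn_integral_sphere) (auto simp: path_weight_eq log_branching_def)
    also have "(\<Sum>y\<in>S i. path_weight child_probability log_branching i G v y) = ?h i"
      by (simp add: path_weight_eq log_branching_def)
    finally show ?thesis using G by (simp add: mass_out_transport_abs)
  qed
  then have "(\<Sum>i = 1..<n. mass_out (transport child_probability log_branching i) g) =
      ennreal (\<Sum>i = 1..<n. ?h i)"
    using nonneg by (simp add: sum_ennreal sum_nonneg)
  moreover have "0 \<le> (\<Sum>i = 1..<n. ?h i)" using nonneg by (intro sum_nonneg) auto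
  moreover have "root_degree g = vdegree G v" using G by (simp add: root_degree.abs_eq)
  moreover have "root_sphere_card n g = card (S n)" using G by (simp add: root_sphere_card.abs_eq)
  ultimately show ?thesis
    using card_sphere_ge[OF assms(3), of c] assms(4)
    by (simp add: mass_out_unit[OF assms(1,2)] flip: ennreal_plus ennreal_mult)
qed

text \<open>The second derivative \<open>(t - 2) / (t - 1)^2\<close> of
  \<open>t * ln (t - 1)\<close> is nonnegative for \<open>t \<ge> 2\<close>, so the function lies
  above its tangent at \<open>d\<close>.\<close>

lemma x_ln_tangent:
  fixes x d :: real
  assumes "2 \<le> x" "2 \<le> d"
  shows "d * ln (d - 1) + (ln (d - 1) + d / (d - 1)) * (x - d) \<le> x * ln (x - 1)"
proof -
  have "(ln (d - 1) + d / (d - 1)) * (x - d) \<le> x * ln (x - 1) - d * ln (d - 1)"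
  proof (rule f''_imp_f'[where C = "{2..}" and f'' = "\<lambda>t. 1 / (t - 1) - 1 / ((t - 1) * (t - 1))"])
    fix t :: real assume t: "t \<in> {2..}"
    then show "((\<lambda>t. t * ln (t - 1)) has_real_derivative ln (t - 1) + t / (t - 1)) (at t)"
      by (auto intro!: derivative_eq_intros)
    from t show "((\<lambda>t. ln (t - 1) + t / (t - 1)) has_real_derivative
        1 / (t - 1) - 1 / ((t - 1) * (t - 1))) (at t)"
      by (auto intro!: derivative_eq_intros simp: diff_divide_distrib)
    from t have "1 / (t - 1) * (1 / (t - 1)) \<le> 1 / (t - 1) * 1" by (intro mult_left_mono) auto
    then show "0 \<le> 1 / (t - 1) - 1 / ((t - 1) * (t - 1))" by simp
  qed (use assms in auto)
  then show ?thesis by simp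
qed

section \<open>Integration over the random tree and the two inequalities\<close>

theorem theorem4:
  fixes M :: "'w measure" and T :: "'w \<Rightarrow> gstar" and r :: nat
  assumes "unimodular_network M T"
    and "AE \<omega> in M. is_tree (T \<omega>)"
    and "integrable M (\<lambda>\<omega>. real (root_degree (T \<omega>)))"
    and "AE \<omega> in M. no_leaves (T \<omega>)"
    and "1 \<le> r"
  shows
    "let d = (\<integral>\<omega>. real (root_degree (T \<omega>)) \<partial>M);
         L = (\<integral>\<^sup>+\<omega>. ennreal (real (root_degree (T \<omega>)) * ln (real (root_degree (T \<omega>)) - 1)) \<partial>M);
         S = (\<integral>\<^sup>+\<omega>. ennreal (real (root_sphere_card r (T \<omega>))) \<partial>M);
         B = ennreal d * exp_ennreal (of_nat (r - 1) * (L / ennreal d))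
     in S \<ge> B \<and> B \<ge> ennreal (d * (d - 1) ^ (r - 1))"
proof -
  have prob: "prob_space M" and T [measurable]: "T \<in> borel_measurable M"
    
    using assms(1) by (auto simp: unimodular_network_def random_rooted_graph_def)
  have transport: "(\<integral>\<^sup>+\<omega>. mass_out f (T \<omega>) \<partial>M) = (\<integral>\<^sup>+\<omega>. mass_in f (T \<omega>) \<partial>M)"
      if "f \<in> borel_measurable borel" for f
    using assms(1) that by (auto simp: unimodular_network_def random_rooted_graph_def)
  interpret prob_space M by (rule prob)
  have AE_tree: "AE \<omega> in M. is_tree (T \<omega>) \<and> no_leaves (T \<omega>)" using assms(2,4) by eventually_elim simp
  note [measurable] = measurable_mass_out_transport borel_measurable_integrable[OF assms(3)]

  define d where "d = (\<integral>\<omega>. real (root_degree (T \<omega>)) \<partial>M)"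
  define L where "L = (\<integral>\<^sup>+\<omega>. ennreal (real (root_degree (T \<omega>)) * ln (real (root_degree (T \<omega>)) - 1)) \<partial>M)"
  define S where "S = (\<integral>\<^sup>+\<omega>. ennreal (real (root_sphere_card r (T \<omega>))) \<partial>M)"
  define B where "B = ennreal d * exp_ennreal (of_nat (r - 1) * (L / ennreal d))"

  have AE_deg: "AE \<omega> in M. 2 \<le> real (root_degree (T \<omega>))"
    using AE_tree by eventually_elim (use root_degree_ge_2 in force)
  have "2 \<le> d"
    using integral_mono_AE[OF _ assms(3), of "\<lambda>_. 2"] AE_deg by (simp add: d_def prob_space)
  have nn_deg: "(\<integral>\<^sup>+\<omega>. ennreal (real (root_degree (T \<omega>))) \<partial>M) = ennreal d"
    unfolding d_def by (rule nn_integral_eq_integral[OF assms(3)]) simp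

  \<comment> \<open>Unimodularity: the expected mass sent to distance \<open>i\<close> equals the
    expected mass received, which is \<open>L\<close> for every positive \<open>i\<close>.\<close>
  have mass: "(\<integral>\<^sup>+\<omega>. mass_out (transport child_probability log_branching i) (T \<omega>) \<partial>M) = L" if "0 < i" for i
  proof -
    have "(\<integral>\<^sup>+\<omega>. mass_in (transport child_probability log_branching i) (T \<omega>) \<partial>M) = L"
      unfolding L_def using AE_tree
      by (intro nn_integral_cong_AE, eventually_elim) (simp add: mass_in_log_branching that)
    then show ?thesis using transport[OF measurable_transport] by metis
  qed
  have S: "S = (\<integral>\<^sup>+\<omega>. mass_out (transport (\<lambda>_. 1) (\<lambda>_. 1) r) (T \<omega>) \<partial>M)"
    unfolding S_def using AE_tree by (intro nn_integral_cong_AE, eventually_elim) (simp add: mass_out_unit)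

  \<comment> \<open>The sum over \<open>1..<r\<close> has \<open>r - 1\<close> terms, each
    integrating to \<open>L\<close>. The inequality is stated in \<open>ennreal\<close> and covers
    infinite \<open>L\<close> or \<open>S\<close>.\<close>
  have main: "ennreal (exp c) * (ennreal d + of_nat (r - 1) * L) \<le> S + ennreal (exp c * c) * ennreal d"
    if "0 \<le> c" for c
  proof -
    have "(\<integral>\<^sup>+\<omega>. ennreal (exp c) * (ennreal (real (root_degree (T \<omega>))) +
          (\<Sum>i = 1..<r. mass_out (transport child_probability log_branching i) (T \<omega>))) \<partial>M)
      \<le> (\<integral>\<^sup>+\<omega>. mass_out (transport (\<lambda>_. 1) (\<lambda>_. 1) r) (T \<omega>) +
          ennreal (exp c * c) * ennreal (real (root_degree (T \<omega>))) \<partial>M)"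
      using AE_tree
      by (intro nn_integral_mono_AE, eventually_elim)
        (rule root_sphere_card_ge, use assms(5) that in auto)
    then show ?thesis
      by (simp add: nn_integral_add nn_integral_sum nn_integral_cmult nn_deg mass S)
  qed

  have "B \<le> S \<and> ennreal (d * (d - 1) ^ (r - 1)) \<le> B"
  proof (cases "L = \<top>")
    case True
    show ?thesis
    proof (cases "r = 1")
      case True
      \<comment> \<open>The exponent is \<open>0 * \<top> = 0\<close> in \<open>ennreal\<close>;
        then \<open>main\<close> at \<open>c = 0\<close> reads \<open>d \<le> S\<close>.\<close>
      then have "B = ennreal d" by (simp add: B_def exp_ennreal_def)
      with True main[of 0] show ?thesis by simp
    next
      case False
      with assms(5) have r: "r - 1 > 0" by simp
      have "of_nat (r - 1) * L = \<top>" using True r by (simp add: ennreal_mult_top)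
      \<comment> \<open>At \<open>c = 0\<close>, \<open>main\<close> reads
        \<open>d + (r - 1) * L \<le> S\<close>.\<close>
      then have "S = \<top>" using main[of 0] by (simp add: top_unique)
      moreover have "of_nat (r - 1) * (L / ennreal d) = \<top>"
        using True r by (simp add: ennreal_top_divide ennreal_mult_top)
      then have "B = \<top>" using \<open>2 \<le> d\<close> by (simp add: B_def exp_ennreal_def ennreal_mult_top)
      ultimately show ?thesis by simp
    qed
  next
    case False
    then obtain l where l: "L = ennreal l" "0 \<le> l" by (cases L) auto
    \<comment> \<open>The exponent in \<open>B\<close>, which is also the best tangent point: it
      maximises \<open>exp c * (d + (r - 1) * l - c * d)\<close>, and the maximum is
      \<open>d * exp c\<close>.\<close>
    define c where "c = real (r - 1) * (l / d)"
    have c: "0 \<le> c" "c * d = real (r - 1) * l" using l(2) \<open>2 \<le> d\<close> by (auto simp: c_def)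
    have "of_nat (r - 1) * (L / ennreal d) = ennreal c"
      using l \<open>2 \<le> d\<close> by (simp add: c_def divide_ennreal ennreal_of_nat_eq_real_of_nat flip: ennreal_mult)
    then have B: "B = ennreal (d * exp c)"
      using c(1) \<open>2 \<le> d\<close> by (simp add: B_def exp_ennreal_def ennreal_mult)
    have "B \<le> S"
    proof (cases S)
      case (real s)
      have "of_nat (r - 1) * L = ennreal (c * d)"
        using l c(2) by (simp add: ennreal_mult ennreal_of_nat_eq_real_of_nat)
      with main[OF c(1)] c(1) \<open>2 \<le> d\<close> real have "exp c * (d + c * d) \<le> s + exp c * c * d"
        by (simp flip: ennreal_plus ennreal_mult)
      \<comment> \<open>After cancelling \<open>exp c * c * d\<close> on both sides,
        \<open>d * exp c \<le> s\<close> remains.\<close>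
      with real show ?thesis by (simp add: B algebra_simps)
    qed simp
    moreover have "ennreal (d * (d - 1) ^ (r - 1)) \<le> B"
    proof -
      let ?f = "\<lambda>\<omega>. real (root_degree (T \<omega>)) * ln (real (root_degree (T \<omega>)) - 1)"
      have nonneg: "AE \<omega> in M. 0 \<le> ?f \<omega>" using AE_deg by eventually_elim simp
      have f: "?f \<in> borel_measurable M" by measurable
      have "has_bochner_integral M ?f l"
        using f nonneg l by (intro has_bochner_integral_nn_integral) (auto simp: L_def)
      then have int: "integrable M ?f" "(\<integral>\<omega>. ?f \<omega> \<partial>M) = l"
        by (auto simp: has_bochner_integral_iff)
      let ?s = "ln (d - 1) + d / (d - 1)"
      \<comment> \<open>The tangent is taken at the mean \<open>d\<close>, so its linear term
        integrates to 0; the result is Jensen's inequality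
        \<open>d * ln (d - 1) \<le> l\<close>.\<close>
      have "(\<integral>\<omega>. d * ln (d - 1) + ?s * (real (root_degree (T \<omega>)) - d) \<partial>M) \<le> (\<integral>\<omega>. ?f \<omega> \<partial>M)"
        using AE_deg assms(3) int(1)
        by (intro integral_mono_AE) (auto elim!: eventually_mono intro!: x_ln_tangent \<open>2 \<le> d\<close>)
      also have "(\<integral>\<omega>. d * ln (d - 1) + ?s * (real (root_degree (T \<omega>)) - d) \<partial>M) = d * ln (d - 1)"
        using assms(3) by (simp add: d_def[symmetric] prob_space)
      finally have "ln (d - 1) \<le> l / d" using int(2) \<open>2 \<le> d\<close> by (simp add: field_simps)
      then have "real (r - 1) * ln (d - 1) \<le> c" unfolding c_def by (intro mult_left_mono) auto
      then have "exp (real (r - 1) * ln (d - 1)) \<le> exp c" by simp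
      then have "(d - 1) ^ (r - 1) \<le> exp c" using \<open>2 \<le> d\<close> by (simp add: exp_of_nat_mult)
      with \<open>2 \<le> d\<close> show ?thesis by (auto simp: B intro!: ennreal_leI mult_left_mono)
    qed
    ultimately show ?thesis by simp
  qed
  then show ?thesis by (simp add: Let_def d_def L_def S_def B_def)
qed

end
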